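(* Let $L$ be a leaf of a holomorphic foliation. For each $x\in L$ choose a transverse germ $(\Sigma_x,\mathcal F_x,x)$ and an analytic envelope $q_x:(\Sigma_x,x)\to(Q_x,o_x)$ satisfying the factorisation property. Let $\mathscr G_L$ be a groupoid whose objects are the points of $L$ and whose arrows $x\to y$ are germs of biholomorphisms $h:(\Sigma_x,x)\to(\Sigma_y,y)$ which map local leaves of $\mathcal F_x$ bijectively onto local leaves of $\mathcal F_y$. Let $\operatorname{Iso}(Q_L)$ be the groupoid with objects $(Q_x,o_x)$, $x\in L$, and arrows the germs of biholomorphisms between them. Then: (1) There is a functor $\mathsf E_L:\mathscr G_L\to\operatorname{Iso}(Q_L)$ which sends an arrow $h:x\to y$ to the unique germ $\bar h:(Q_x,o_x)\to(Q_y,o_y)$ satisfying $q_y\circ h=\bar h\circ q_x$. (2) For $x\in L$ set $\mathscr K_x=\{h\in\mathscr G_L(x,x):\mathsf E_L(h)=\operatorname{id}_{Q_x}\}$. The groups $\mathscr K_x$ form a wide normal subgroupoid $\mathscr K_L\subset\mathscr G_L$, and $\mathsf E_L$ factors through a faithful functor $$\overline{\mathsf E}_L:\mathscr G_L^{\mathrm{env}}:=\mathscr G_L/\mathscr K_L\longrightarrow\operatorname{Iso}(Q_L).$$ (3) Moreover, $\mathscr K_x=\{h\in\mathscr G_L(x,x):h^*f=f\text{ for every }f\in\mathcal O_{\Sigma_x,x}^{\mathcal F_x}\}$.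
   Context: A transverse germ $(\Sigma_x,\mathcal F_x,x)$ is a germ at $x$ of a transversal to $L$ with the induced (possibly singular) holomorphic foliation; local leaves are its connected leaves in small neighbourhoods of $x$. $\mathcal O_{\Sigma_x,x}^{\mathcal F_x}$ is the ring of holomorphic germs constant on local leaves (first integrals). An analytic envelope with the factorisation property is a germ of holomorphic map $q:(\Sigma,x)\to(Q,o)$ to a complex analytic germ, constant on local leaves, such that $q^*\mathcal O_{Q,o}=\mathcal O_{\Sigma,x}^{\mathcal F}$ and every germ of holomorphic map $F:(\Sigma,x)\to(Y,y)$ to a complex analytic germ that is constant along local leaves factors uniquely through $q$. *)

theory Defs
  imports "HOL-Analysis.Analysis"
begin

section \<open>Holomorphic functions of several variables\<close>

text \<open>
  As for the library's \<^const>\<open>Euclidean_space\<close>, the space $C^n$ consists of the sequences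
  that vanish from index n on, so that dimensions can vary inside a formula and $C^d$ is a
  subset of $C^n$ for d at most n. Only values at points of this set ever matter.
\<close>

type_synonym cvec = "nat \<Rightarrow> complex"

definition Cn :: "nat \<Rightarrow> cvec set"
  where "Cn n = {z. \<forall>i\<ge>n. z i = 0}"

abbreviation ctop :: "nat \<Rightarrow> cvec topology"
  where "ctop n \<equiv> top_of_set (Cn n)"

abbreviation origin :: cvec
  where "origin \<equiv> (\<lambda>_. 0)"

definition complex_differentiable_at :: "nat \<Rightarrow> (cvec \<Rightarrow> complex) \<Rightarrow> cvec \<Rightarrow> bool"
  where "complex_differentiable_at n f a \<longleftrightarrow>
    (\<exists>c. ((\<lambda>z. (f z - f a - (\<Sum>i<n. c i * (z i - a i))) /
               of_real (L2_set (\<lambda>i. cmod (z i - a i)) {..<n})) \<longlongrightarrow> 0) (at a within Cn n))"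

definition hol_near :: "nat \<Rightarrow> (cvec \<Rightarrow> complex) \<Rightarrow> cvec \<Rightarrow> bool"
  where "hol_near n f a \<longleftrightarrow>
    a \<in> Cn n \<and> eventually (\<lambda>z. complex_differentiable_at n f z) (nhdsin (ctop n) a)"


section \<open>Complex manifolds\<close>

record 'a cmanifold =
  top_of :: "'a topology"
  dim_of :: nat
  charts_of :: "('a set \<times> ('a \<Rightarrow> cvec)) set"

abbreviation points :: "'a cmanifold \<Rightarrow> 'a set"
  where "points M \<equiv> topspace (top_of M)"

abbreviation opn :: "'a cmanifold \<Rightarrow> 'a set \<Rightarrow> bool"
  where "opn M U \<equiv> openin (top_of M) U"

definition complex_manifold :: "'a cmanifold \<Rightarrow> bool"
  where "complex_manifold M \<longleftrightarrow>
    Hausdorff_space (top_of M) \<and> second_countable (top_of M) \<and>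
    (\<Union>(U, \<phi>) \<in> charts_of M. U) = points M \<and>
    (\<forall>(U, \<phi>) \<in> charts_of M.
        opn M U \<and> openin (ctop (dim_of M)) (\<phi> ` U) \<and>
        homeomorphic_map (subtopology (top_of M) U) (top_of_set (\<phi> ` U)) \<phi>) \<and>
    (\<forall>(U, \<phi>) \<in> charts_of M. \<forall>(V, \<psi>) \<in> charts_of M. \<forall>p \<in> U \<inter> V. \<forall>i < dim_of M.
        hol_near (dim_of M) (\<lambda>z. \<psi> (inv_into U \<phi> z) i) (\<phi> p))"

text \<open>Charts of the maximal atlas.\<close>

definition holomorphic_chart :: "'a cmanifold \<Rightarrow> 'a set \<Rightarrow> ('a \<Rightarrow> cvec) \<Rightarrow> bool"
  where "holomorphic_chart M U \<phi> \<longleftrightarrow>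
    complex_manifold (M\<lparr>charts_of := insert (U, \<phi>) (charts_of M)\<rparr>)"

definition embedded_submanifold :: "'a cmanifold \<Rightarrow> 'a cmanifold \<Rightarrow> bool"
  where "embedded_submanifold S M \<longleftrightarrow>
    complex_manifold S \<and> points S \<subseteq> points M \<and> dim_of S \<le> dim_of M \<and>
    top_of S = subtopology (top_of M) (points S) \<and>
    (\<forall>p \<in> points S. \<exists>U \<psi>. p \<in> U \<and> holomorphic_chart M U \<psi> \<and>
        \<psi> ` (U \<inter> points S) = \<psi> ` U \<inter> Cn (dim_of S) \<and>
        holomorphic_chart S (U \<inter> points S) \<psi>)"

definition hol_at :: "'a cmanifold \<Rightarrow> ('a \<Rightarrow> complex) \<Rightarrow> 'a \<Rightarrow> bool"
  where "hol_at M f p \<longleftrightarrow> p \<in> points M \<and>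
    (\<forall>(U, \<phi>) \<in> charts_of M. p \<in> U \<longrightarrow> hol_near (dim_of M) (\<lambda>z. f (inv_into U \<phi> z)) (\<phi> p))"

definition holomorphic_map_on :: "'a cmanifold \<Rightarrow> 'b cmanifold \<Rightarrow> 'a set \<Rightarrow> ('a \<Rightarrow> 'b) \<Rightarrow> bool"
  where "holomorphic_map_on M N U h \<longleftrightarrow>
    opn M U \<and> continuous_map (subtopology (top_of M) U) (top_of N) h \<and>
    (\<forall>p \<in> U. \<forall>(V, \<phi>) \<in> charts_of M. \<forall>(W, \<psi>) \<in> charts_of N. p \<in> V \<and> h p \<in> W \<longrightarrow>
        (\<forall>i < dim_of N. hol_near (dim_of M) (\<lambda>z. \<psi> (h (inv_into V \<phi> z)) i) (\<phi> p)))"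


section \<open>Singular holomorphic foliations\<close>

text \<open>
  Tangent vectors are derivations of the algebra of holomorphic germs, and holomorphic vector
  fields are derivations of the structure sheaf. To make equality of operators the equality of
  vectors and fields, the value is 0 wherever it is not meaningful: on functions that are not
  holomorphic near the point, and outside the domain.
\<close>

definition tangent_space :: "'a cmanifold \<Rightarrow> 'a \<Rightarrow> (('a \<Rightarrow> complex) \<Rightarrow> complex) set"
  where "tangent_space M p = {v.
    (\<forall>f. \<not> hol_at M f p \<longrightarrow> v f = 0) \<and>
    (\<forall>f g. hol_at M f p \<and> hol_at M g p \<longrightarrow>
        (eventually (\<lambda>r. f r = g r) (nhdsin (top_of M) p) \<longrightarrow> v f = v g) \<and>
        v (\<lambda>r. f r + g r) = v f + v g \<and>
        v (\<lambda>r. f r * g r) = f p * v g + g p * v f) \<and>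
    (\<forall>f c. hol_at M f p \<longrightarrow> v (\<lambda>r. c * f r) = c * v f)}"

type_synonym 'a vfield = "('a \<Rightarrow> complex) \<Rightarrow> 'a \<Rightarrow> complex"

definition vector_fields :: "'a cmanifold \<Rightarrow> 'a set \<Rightarrow> 'a vfield set"
  where "vector_fields M W = {X.
    (\<forall>p \<in> W. (\<lambda>f. X f p) \<in> tangent_space M p \<and> (\<forall>f. hol_at M f p \<longrightarrow> hol_at M (X f) p)) \<and>
    (\<forall>p f. p \<notin> W \<longrightarrow> X f p = 0)}"

definition vrestrict :: "'a set \<Rightarrow> 'a vfield \<Rightarrow> 'a vfield"
  where "vrestrict V X = (\<lambda>f p. if p \<in> V then X f p else 0)"

definition lie_bracket :: "'a cmanifold \<Rightarrow> 'a vfield \<Rightarrow> 'a vfield \<Rightarrow> 'a vfield"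
  where "lie_bracket M X Y = (\<lambda>f p. if hol_at M f p then X (Y f) p - Y (X f) p else 0)"

text \<open>
  A singular holomorphic foliation is an involutive, locally finitely generated sheaf of
  O-submodules of the tangent sheaf.
\<close>

type_synonym 'a foliation = "'a set \<Rightarrow> 'a vfield set"

definition holomorphic_foliation :: "'a cmanifold \<Rightarrow> 'a foliation \<Rightarrow> bool"
  where "holomorphic_foliation M F \<longleftrightarrow>
    (\<forall>W. opn M W \<longrightarrow>
        F W \<subseteq> vector_fields M W \<and>
        (\<lambda>f p. 0) \<in> F W \<and>
        (\<forall>X \<in> F W. \<forall>Y \<in> F W. (\<lambda>f p. X f p + Y f p) \<in> F W) \<and>
        (\<forall>X \<in> F W. \<forall>a. (\<forall>p \<in> W. hol_at M a p) \<longrightarrow> (\<lambda>f p. a p * X f p) \<in> F W) \<and>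
        (\<forall>X \<in> F W. \<forall>V. opn M V \<and> V \<subseteq> W \<longrightarrow> vrestrict V X \<in> F V) \<and>
        (\<forall>X \<in> vector_fields M W.
            (\<forall>p \<in> W. \<exists>V. opn M V \<and> p \<in> V \<and> V \<subseteq> W \<and> vrestrict V X \<in> F V) \<longrightarrow> X \<in> F W) \<and>
        (\<forall>X \<in> F W. \<forall>Y \<in> F W. lie_bracket M X Y \<in> F W)) \<and>
    (\<forall>p \<in> points M. \<exists>W G. opn M W \<and> p \<in> W \<and> finite G \<and> G \<subseteq> F W \<and>
        (\<forall>V Y r. opn M V \<and> V \<subseteq> W \<and> Y \<in> F V \<and> r \<in> V \<longrightarrow>
            (\<exists>V' a. opn M V' \<and> r \<in> V' \<and> V' \<subseteq> V \<and>
                (\<forall>X \<in> G. \<forall>s \<in> V'. hol_at M (a X) s) \<and>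
                (\<forall>f. \<forall>s \<in> V'. Y f s = (\<Sum>X \<in> G. a X s * X f s)))))"

text \<open>
  The leaves in an open set U are the orbits (in the sense of Sussmann and Nagano) of the local
  sections over open subsets of U: two points lie on the same leaf iff they are joined by a
  concatenation of integral curves. In particular the leaves are connected. Steps can be
  reversed, by passing to -X, so that the orbits partition U.
\<close>

definition flow_step :: "'a cmanifold \<Rightarrow> 'a foliation \<Rightarrow> 'a set \<Rightarrow> 'a \<Rightarrow> 'a \<Rightarrow> bool"
  where "flow_step M F U p r \<longleftrightarrow>
    (\<exists>V X \<gamma>. opn M V \<and> V \<subseteq> U \<and> X \<in> F V \<and>
        pathin (top_of M) \<gamma> \<and> \<gamma> ` {0..1} \<subseteq> V \<and> \<gamma> 0 = p \<and> \<gamma> 1 = r \<and>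
        (\<forall>t \<in> {0..1}. \<forall>f. hol_at M f (\<gamma> t) \<longrightarrow>
            ((\<lambda>s. f (\<gamma> s)) has_vector_derivative X f (\<gamma> t)) (at t within {0..1})))"

definition leaf_through :: "'a cmanifold \<Rightarrow> 'a foliation \<Rightarrow> 'a set \<Rightarrow> 'a \<Rightarrow> 'a set"
  where "leaf_through M F U p = {r. (flow_step M F U)\<^sup>*\<^sup>* p r}"

definition leaves :: "'a cmanifold \<Rightarrow> 'a foliation \<Rightarrow> 'a set \<Rightarrow> 'a set set"
  where "leaves M F U = leaf_through M F U ` U"

definition leaf_tangent_space ::
    "'a cmanifold \<Rightarrow> 'a foliation \<Rightarrow> 'a \<Rightarrow> (('a \<Rightarrow> complex) \<Rightarrow> complex) set"
  where "leaf_tangent_space M F p = {(\<lambda>f. X f p) | X W. opn M W \<and> p \<in> W \<and> X \<in> F W}"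

definition submanifold_tangent_space ::
    "'a cmanifold \<Rightarrow> 'a cmanifold \<Rightarrow> 'a \<Rightarrow> (('a \<Rightarrow> complex) \<Rightarrow> complex) set"
  where "submanifold_tangent_space M S p = {v \<in> tangent_space M p.
    \<forall>f. hol_at M f p \<and> eventually (\<lambda>r. f r = 0) (nhdsin (top_of S) p) \<longrightarrow> v f = 0}"

text \<open>
  S represents the germ at x of a transversal to the leaf through x: the tangent space of the
  ambient manifold at x is the direct sum of the tangent spaces of the leaf and of S.
\<close>

definition transversal_at :: "'a cmanifold \<Rightarrow> 'a foliation \<Rightarrow> 'a cmanifold \<Rightarrow> 'a \<Rightarrow> bool"
  where "transversal_at M F S x \<longleftrightarrow>
    embedded_submanifold S M \<and> x \<in> points S \<and>
    leaf_tangent_space M F x \<inter> submanifold_tangent_space M S x = {\<lambda>f. 0} \<and>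
    (\<forall>v \<in> tangent_space M x. \<exists>u \<in> leaf_tangent_space M F x.
        \<exists>w \<in> submanifold_tangent_space M S x. v = (\<lambda>f. u f + w f))"

text \<open>
  The foliation induced on S consists of the restrictions to S of the sections of F that are
  tangent to S. Tangency is implicit: Y f depends only on the restriction of f to S.
\<close>

definition induced_foliation :: "'a cmanifold \<Rightarrow> 'a foliation \<Rightarrow> 'a cmanifold \<Rightarrow> 'a foliation"
  where "induced_foliation M F S W = {Y \<in> vector_fields S W.
    \<forall>p \<in> W. \<exists>V X. opn M V \<and> p \<in> V \<and> V \<inter> points S \<subseteq> W \<and> X \<in> F V \<and>
        (\<forall>f. \<forall>r \<in> V \<inter> points S. hol_at M f r \<longrightarrow> Y f r = X f r)}"


section \<open>Germs on a foliated manifold\<close>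

definition germ :: "'a topology \<Rightarrow> 'a \<Rightarrow> ('a \<Rightarrow> 'b) \<Rightarrow> ('a \<Rightarrow> 'b) set"
  where "germ T x f = {g. eventually (\<lambda>p. g p = f p) (nhdsin T x)}"

text \<open>Composition of a germ at x with a class of functions defined near its value.\<close>

definition germ_comp ::
    "'a topology \<Rightarrow> 'a \<Rightarrow> ('b \<Rightarrow> 'c) set \<Rightarrow> ('a \<Rightarrow> 'b) set \<Rightarrow> ('a \<Rightarrow> 'c) set"
  where "germ_comp T x B A =
    {k. \<exists>g \<in> B. \<exists>h \<in> A. eventually (\<lambda>p. k p = g (h p)) (nhdsin T x)}"

definition constant_on_local_leaves ::
    "'a cmanifold \<Rightarrow> 'a foliation \<Rightarrow> 'a \<Rightarrow> ('a \<Rightarrow> 'b) \<Rightarrow> bool"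
  where "constant_on_local_leaves S F x f \<longleftrightarrow>
    (\<exists>U. opn S U \<and> x \<in> U \<and> (\<forall>A \<in> leaves S F U. \<forall>p \<in> A. \<forall>r \<in> A. f p = f r))"

definition first_integrals :: "'a cmanifold \<Rightarrow> 'a foliation \<Rightarrow> 'a \<Rightarrow> ('a \<Rightarrow> complex) set set"
  where "first_integrals S F x =
    {germ (top_of S) x f | f. hol_at S f x \<and> constant_on_local_leaves S F x f}"

definition biholomorphic_at :: "'a cmanifold \<Rightarrow> 'a \<Rightarrow> 'b cmanifold \<Rightarrow> 'b \<Rightarrow> ('a \<Rightarrow> 'b) \<Rightarrow> bool"
  where "biholomorphic_at S x T y h \<longleftrightarrow> h x = y \<and>
    (\<exists>U V. x \<in> U \<and> y \<in> V \<and> bij_betw h U V \<and>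
        holomorphic_map_on S T U h \<and> holomorphic_map_on T S V (inv_into U h))"

definition preserves_local_leaves ::
    "'a cmanifold \<Rightarrow> 'a foliation \<Rightarrow> 'a \<Rightarrow> 'b cmanifold \<Rightarrow> 'b foliation \<Rightarrow> ('a \<Rightarrow> 'b) \<Rightarrow> bool"
  where "preserves_local_leaves S F x T F' h \<longleftrightarrow>
    (\<exists>U\<^sub>0. opn S U\<^sub>0 \<and> x \<in> U\<^sub>0 \<and> (\<forall>U. opn S U \<and> x \<in> U \<and> U \<subseteq> U\<^sub>0 \<longrightarrow>
        bij_betw (image h) (leaves S F U) (leaves T F' (h ` U))))"

definition leaf_preserving_germs ::
    "'a cmanifold \<Rightarrow> 'a foliation \<Rightarrow> 'a \<Rightarrow> 'b cmanifold \<Rightarrow> 'b foliation \<Rightarrow> 'b \<Rightarrow> ('a \<Rightarrow> 'b) set set"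
  where "leaf_preserving_germs S F x T F' y =
    {germ (top_of S) x h | h. biholomorphic_at S x T y h \<and> preserves_local_leaves S F x T F' h}"


section \<open>Complex analytic germs\<close>

text \<open>
  A germ of a complex space (not necessarily reduced) is given by a local model, that is by the
  number n of ambient coordinates and a proper ideal I of the ring of germs at 0 of holomorphic
  functions on $C^n$; its local ring is the quotient by I. The ideal is represented by the set
  of all functions whose germ lies in it; it is automatically finitely generated.
\<close>

type_synonym agerm = "nat \<times> (cvec \<Rightarrow> complex) set"

definition analytic_germ :: "agerm \<Rightarrow> bool"
  where "analytic_germ = (\<lambda>(n, I).
    (\<forall>f \<in> I. hol_near n f origin) \<and>
    (\<forall>f \<in> I. germ (ctop n) origin f \<subseteq> I) \<and>
    (\<lambda>z. 0) \<in> I \<and> (\<lambda>z. 1) \<notin> I \<and>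
    (\<forall>f \<in> I. \<forall>g \<in> I. (\<lambda>z. f z + g z) \<in> I) \<and>
    (\<forall>f \<in> I. \<forall>g. hol_near n g origin \<longrightarrow> (\<lambda>z. g z * f z) \<in> I))"

text \<open>
  Germs of holomorphic maps between local models are induced by ambient holomorphic maps pulling
  the ideal of the target back into the ideal of the source, two of them being identified if
  their components agree modulo the ideal of the source.
\<close>

definition amap_rep :: "agerm \<Rightarrow> agerm \<Rightarrow> (cvec \<Rightarrow> cvec) \<Rightarrow> bool"
  where "amap_rep = (\<lambda>(n, I) (m, J) \<phi>.
    \<phi> origin = origin \<and>
    eventually (\<lambda>z. \<phi> z \<in> Cn m) (nhdsin (ctop n) origin) \<and>
    (\<forall>i < m. hol_near n (\<lambda>z. \<phi> z i) origin) \<and>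
    (\<forall>g \<in> J. (\<lambda>z. g (\<phi> z)) \<in> I))"

definition amap_class :: "agerm \<Rightarrow> agerm \<Rightarrow> (cvec \<Rightarrow> cvec) \<Rightarrow> (cvec \<Rightarrow> cvec) set"
  where "amap_class A B \<phi> =
    {\<psi>. amap_rep A B \<psi> \<and> (\<forall>i < fst B. (\<lambda>z. \<psi> z i - \<phi> z i) \<in> snd A)}"

definition amaps :: "agerm \<Rightarrow> agerm \<Rightarrow> (cvec \<Rightarrow> cvec) set set"
  where "amaps A B = {amap_class A B \<phi> | \<phi>. amap_rep A B \<phi>}"

definition amap_id :: "agerm \<Rightarrow> (cvec \<Rightarrow> cvec) set"
  where "amap_id A = amap_class A A (\<lambda>z. z)"

definition amap_comp ::
    "agerm \<Rightarrow> agerm \<Rightarrow> agerm \<Rightarrow> (cvec \<Rightarrow> cvec) set \<Rightarrow> (cvec \<Rightarrow> cvec) set \<Rightarrow> (cvec \<Rightarrow> cvec) set"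
  where "amap_comp A B C \<Psi> \<Phi> = (\<Union>\<psi> \<in> \<Psi>. \<Union>\<phi> \<in> \<Phi>. amap_class A C (\<lambda>z. \<psi> (\<phi> z)))"

definition aisos :: "agerm \<Rightarrow> agerm \<Rightarrow> (cvec \<Rightarrow> cvec) set set"
  where "aisos A B = {\<Phi> \<in> amaps A B. \<exists>\<Psi> \<in> amaps B A.
    amap_comp A B A \<Psi> \<Phi> = amap_id A \<and> amap_comp B A B \<Phi> \<Psi> = amap_id B}"

text \<open>
  Germs of holomorphic maps from a manifold to an analytic germ. The structure sheaf of the
  source being reduced, the pullback of the ideal has to vanish.
\<close>

definition maps_to_agerm :: "'a cmanifold \<Rightarrow> 'a \<Rightarrow> agerm \<Rightarrow> ('a \<Rightarrow> cvec) set set"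
  where "maps_to_agerm S x = (\<lambda>(m, J). {germ (top_of S) x k | k.
    k x = origin \<and>
    eventually (\<lambda>p. k p \<in> Cn m) (nhdsin (top_of S) x) \<and>
    (\<forall>i < m. hol_at S (\<lambda>p. k p i) x) \<and>
    (\<forall>g \<in> J. eventually (\<lambda>p. g (k p) = 0) (nhdsin (top_of S) x))})"

definition pullback_ring ::
    "'a cmanifold \<Rightarrow> 'a \<Rightarrow> agerm \<Rightarrow> ('a \<Rightarrow> cvec) set \<Rightarrow> ('a \<Rightarrow> complex) set set"
  where "pullback_ring S x Q q =
    {germ (top_of S) x (\<lambda>p. f (k p)) | f k. hol_near (fst Q) f origin \<and> k \<in> q}"

definition leafwise_constant_maps ::
    "'a cmanifold \<Rightarrow> 'a foliation \<Rightarrow> 'a \<Rightarrow> agerm \<Rightarrow> ('a \<Rightarrow> cvec) set set"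
  where "leafwise_constant_maps S F x Y =
    {k \<in> maps_to_agerm S x Y. \<exists>f \<in> k. constant_on_local_leaves S F x f}"

definition analytic_envelope ::
    "'a cmanifold \<Rightarrow> 'a foliation \<Rightarrow> 'a \<Rightarrow> agerm \<Rightarrow> ('a \<Rightarrow> cvec) set \<Rightarrow> bool"
  where "analytic_envelope S F x Q q \<longleftrightarrow>
    analytic_germ Q \<and> q \<in> leafwise_constant_maps S F x Q \<and>
    pullback_ring S x Q q = first_integrals S F x \<and>
    (\<forall>Y. analytic_germ Y \<longrightarrow> (\<forall>k \<in> leafwise_constant_maps S F x Y.
        \<exists>!\<Phi>. \<Phi> \<in> amaps Q Y \<and> germ_comp (top_of S) x \<Phi> q = k))"


section \<open>Groupoids\<close>

text \<open>\<open>Cmp G x y z g f\<close> is the composite of \<open>f : x \<rightarrow> y\<close> and \<open>g : y \<rightarrow> z\<close>.\<close>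

record ('o, 'm) groupoid_data =
  Obj :: "'o set"
  Hom :: "'o \<Rightarrow> 'o \<Rightarrow> 'm set"
  Idn :: "'o \<Rightarrow> 'm"
  Cmp :: "'o \<Rightarrow> 'o \<Rightarrow> 'o \<Rightarrow> 'm \<Rightarrow> 'm \<Rightarrow> 'm"

definition inverse_arrows :: "('o, 'm) groupoid_data \<Rightarrow> 'o \<Rightarrow> 'o \<Rightarrow> 'm \<Rightarrow> 'm \<Rightarrow> bool"
  where "inverse_arrows G x y f g \<longleftrightarrow> f \<in> Hom G x y \<and> g \<in> Hom G y x \<and>
    Cmp G x y x g f = Idn G x \<and> Cmp G y x y f g = Idn G y"

definition groupoid :: "('o, 'm) groupoid_data \<Rightarrow> bool"
  where "groupoid G \<longleftrightarrow>
    (\<forall>x \<in> Obj G. Idn G x \<in> Hom G x x) \<and>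
    (\<forall>x \<in> Obj G. \<forall>y \<in> Obj G. \<forall>z \<in> Obj G. \<forall>f \<in> Hom G x y. \<forall>g \<in> Hom G y z.
        Cmp G x y z g f \<in> Hom G x z) \<and>
    (\<forall>x \<in> Obj G. \<forall>y \<in> Obj G. \<forall>f \<in> Hom G x y.
        Cmp G x x y f (Idn G x) = f \<and> Cmp G x y y (Idn G y) f = f) \<and>
    (\<forall>w \<in> Obj G. \<forall>x \<in> Obj G. \<forall>y \<in> Obj G. \<forall>z \<in> Obj G.
        \<forall>f \<in> Hom G w x. \<forall>g \<in> Hom G x y. \<forall>h \<in> Hom G y z.
        Cmp G w x z (Cmp G x y z h g) f = Cmp G w y z h (Cmp G w x y g f)) \<and>
    (\<forall>x \<in> Obj G. \<forall>y \<in> Obj G. \<forall>f \<in> Hom G x y. \<exists>g. inverse_arrows G x y f g)"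

definition groupoid_functor ::
    "('o, 'm) groupoid_data \<Rightarrow> ('p, 'n) groupoid_data \<Rightarrow> ('o \<Rightarrow> 'p) \<Rightarrow> ('o \<Rightarrow> 'o \<Rightarrow> 'm \<Rightarrow> 'n) \<Rightarrow> bool"
  where "groupoid_functor G H Eo E \<longleftrightarrow> groupoid G \<and> groupoid H \<and>
    (\<forall>x \<in> Obj G. Eo x \<in> Obj H \<and> E x x (Idn G x) = Idn H (Eo x)) \<and>
    (\<forall>x \<in> Obj G. \<forall>y \<in> Obj G. \<forall>f \<in> Hom G x y. E x y f \<in> Hom H (Eo x) (Eo y)) \<and>
    (\<forall>x \<in> Obj G. \<forall>y \<in> Obj G. \<forall>z \<in> Obj G. \<forall>f \<in> Hom G x y. \<forall>g \<in> Hom G y z.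
        E x z (Cmp G x y z g f) = Cmp H (Eo x) (Eo y) (Eo z) (E y z g) (E x y f))"

definition faithful_on :: "('o, 'm) groupoid_data \<Rightarrow> ('o \<Rightarrow> 'o \<Rightarrow> 'm \<Rightarrow> 'n) \<Rightarrow> bool"
  where "faithful_on G E \<longleftrightarrow> (\<forall>x \<in> Obj G. \<forall>y \<in> Obj G. inj_on (E x y) (Hom G x y))"

definition wide_normal_subgroupoid ::
    "('o, 'm) groupoid_data \<Rightarrow> ('o, 'm) groupoid_data \<Rightarrow> bool"
  where "wide_normal_subgroupoid K G \<longleftrightarrow> groupoid G \<and> groupoid K \<and>
    Obj K = Obj G \<and> Idn K = Idn G \<and> Cmp K = Cmp G \<and>
    (\<forall>x \<in> Obj G. \<forall>y \<in> Obj G. Hom K x y \<subseteq> Hom G x y) \<and>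
    (\<forall>x \<in> Obj G. \<forall>y \<in> Obj G. \<forall>k \<in> Hom K x x. \<forall>g g'. inverse_arrows G x y g g' \<longrightarrow>
        Cmp G y x y g (Cmp G y x x k g') \<in> Hom K y y)"

text \<open>The subgroupoid consisting of a family of sets of arrows from x to x, one for each x.\<close>

definition bundle_subgroupoid ::
    "('o, 'm) groupoid_data \<Rightarrow> ('o \<Rightarrow> 'm set) \<Rightarrow> ('o, 'm) groupoid_data"
  where "bundle_subgroupoid G K = G\<lparr>Hom := (\<lambda>x y. if x = y then K x else {})\<rparr>"

text \<open>
  The quotient by a normal subgroupoid K without arrows between different objects; the objects
  are then unchanged, and arrows are cosets modulo the groups \<open>Hom K x x\<close>.
\<close>

definition arrow_coset ::
    "('o, 'm) groupoid_data \<Rightarrow> ('o, 'm) groupoid_data \<Rightarrow> 'o \<Rightarrow> 'o \<Rightarrow> 'm \<Rightarrow> 'm set"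
  where "arrow_coset G K x y h = (\<lambda>k. Cmp G x x y h k) ` Hom K x x"

definition quotient_groupoid ::
    "('o, 'm) groupoid_data \<Rightarrow> ('o, 'm) groupoid_data \<Rightarrow> ('o, 'm set) groupoid_data"
  where "quotient_groupoid G K = \<lparr>
    Obj = Obj G,
    Hom = (\<lambda>x y. arrow_coset G K x y ` Hom G x y),
    Idn = (\<lambda>x. arrow_coset G K x x (Idn G x)),
    Cmp = (\<lambda>x y z B A. {Cmp G x y z b a | b a. b \<in> B \<and> a \<in> A})\<rparr>"


section \<open>The groupoids attached to a leaf\<close>

definition germ_groupoid ::
    "'a set \<Rightarrow> ('a \<Rightarrow> 'a cmanifold) \<Rightarrow> ('a \<Rightarrow> 'a \<Rightarrow> ('a \<Rightarrow> 'a) set set) \<Rightarrow>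
     ('a, ('a \<Rightarrow> 'a) set) groupoid_data"
  where "germ_groupoid L S H = \<lparr>
    Obj = L,
    Hom = H,
    Idn = (\<lambda>x. germ (top_of (S x)) x (\<lambda>p. p)),
    Cmp = (\<lambda>x y z. germ_comp (top_of (S x)) x)\<rparr>"

definition Iso_groupoid :: "agerm set \<Rightarrow> (agerm, (cvec \<Rightarrow> cvec) set) groupoid_data"
  where "Iso_groupoid Qs = \<lparr>Obj = Qs, Hom = aisos, Idn = amap_id, Cmp = amap_comp\<rparr>"

end

theory Submission
  imports Defs
begin

text \<open>
  The induced germ on the envelopes exists and is unique because the composite of the envelope
  of the target with a leaf preserving germ is again constant on local leaves. Uniqueness then gives
  functoriality.

  The local rings of the envelopes need not be assumed reduced. The uniqueness clause of the factorisation
  property, applied to maps into the complex line, shows that the ideal of the envelope consists of all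
  functions that pull back to zero, so that morphisms between envelopes may be compared after
  composition with the envelope map. This is what makes their composition well defined.

  The cosets modulo the kernel of a functor are its fibres on the sets of arrows, whence the
  faithful factorisation. Finally, an arrow from x to x has trivial image iff composing with it
  fixes the envelope map, that is, iff it fixes the coordinates of that map, and these are first
  integrals that generate all others by composition.
\<close>

section \<open>Holomorphic functions near a point\<close>

text \<open>The analytic input is the stability of holomorphic germs under composition, in C^n and
  across charts. As differentiability is required at all points near the base point, a pointwise
  chain rule is enough.

  The difficulty is that two notions of equality meet. Germs on transversals are equal when
  functions agree near x, whereas morphisms of envelopes are classes modulo an ideal, and their
  composite is a union over all representatives. A map from a manifold that detects the ideal
  translates the second notion into the first. For this reason the isomorphism groupoid is built on
  analytic germs that carry such a map.

  Invertibility of an induced germ comes from the groupoid of arrows and not from an inverse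
  function theorem: the inverse arrow induces the inverse germ. Passing to the quotient by the
  kernel is pure algebra and is carried out for an arbitrary functor of groupoids.\<close>

lemma eventually_nhdsin_self:
  "eventually P (nhdsin T a) \<Longrightarrow> a \<in> topspace T \<Longrightarrow> P a"
  by (auto simp: eventually_nhdsin)

lemma eventually_nhdsinI:
  "openin T U \<Longrightarrow> a \<in> U \<Longrightarrow> (\<And>p. p \<in> U \<Longrightarrow> P p) \<Longrightarrow> eventually P (nhdsin T a)"
  by (auto simp: eventually_nhdsin)

lemma eventually_eventually_nhdsin:
  "eventually P (nhdsin T a) \<Longrightarrow> eventually (\<lambda>b. eventually P (nhdsin T b)) (nhdsin T a)"
  unfolding eventually_nhdsin by blast

text \<open>Links the abstract topologies of \<open>ctop\<close> with type-class filters, so that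
  the usual calculus of limits applies.\<close>

lemma nhdsin_top_of_set:
  assumes "a \<in> X"
  shows "nhdsin (top_of_set X) a = inf (nhds a) (principal X)"
proof (rule filter_eqI)
  fix P
  have "eventually P (nhdsin (top_of_set X) a) \<longleftrightarrow> (\<exists>T. open T \<and> a \<in> X \<inter> T \<and> (\<forall>x\<in>X \<inter> T. P x))"
    using assms unfolding eventually_nhdsin openin_open by auto
  also have "\<dots> \<longleftrightarrow> (\<exists>T. open T \<and> a \<in> T \<and> (\<forall>x\<in>T. x \<in> X \<longrightarrow> P x))"
    using assms by blast
  finally show "eventually P (nhdsin (top_of_set X) a) \<longleftrightarrow> eventually P (inf (nhds a) (principal X))"
    by (simp add: eventually_inf_principal eventually_nhds)
qed

lemma tendsto_fun_iff:
  fixes f :: "'a \<Rightarrow> 'b \<Rightarrow> 'c::topological_space"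
  shows "(f \<longlongrightarrow> l) A \<longleftrightarrow> (\<forall>i. ((\<lambda>x. f x i) \<longlongrightarrow> l i) A)"
  using limitin_componentwise[of "\<lambda>_. euclidean" UNIV f l A]
  unfolding limitin_canonical_iff euclidean_product_topology by simp

text \<open>Convergence of sequences is coordinatewise, and within \<open>Cn m\<close> the
  coordinates from m on are constantly 0, so finitely many limits remain to be checked.\<close>

lemma filterlim_nhdsin_ctop_iff:
  assumes "b \<in> Cn m"
  shows "filterlim \<phi> (nhdsin (ctop m) b) A \<longleftrightarrow>
    eventually (\<lambda>z. \<phi> z \<in> Cn m) A \<and> (\<forall>i<m. ((\<lambda>z. \<phi> z i) \<longlongrightarrow> b i) A)"
proof -
  have "((\<lambda>z. \<phi> z i) \<longlongrightarrow> b i) A" if "eventually (\<lambda>z. \<phi> z \<in> Cn m) A" "\<not> i < m" for i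
  proof (rule tendsto_eventually, rule eventually_mono[OF that(1)])
    show "\<phi> z i = b i" if "\<phi> z \<in> Cn m" for z
      using that assms \<open>\<not> i < m\<close> by (simp add: Cn_def)
  qed
  then show ?thesis
    unfolding nhdsin_top_of_set[OF assms] filterlim_inf filterlim_principal tendsto_fun_iff[of \<phi>]
    by metis
qed

lemma tendsto_coordinate:
  assumes "a \<in> Cn n"
  shows "((\<lambda>z. z i) \<longlongrightarrow> a i) (nhdsin (ctop n) a)"
proof -
  have "filterlim (\<lambda>z. z) (nhds a) (nhdsin (ctop n) a)"
    by (simp add: nhdsin_top_of_set[OF assms] filterlim_def)
  then show ?thesis unfolding tendsto_fun_iff[of "\<lambda>z. z"] by (rule spec)
qed

text \<open>Caratheodory's form of differentiability, in which the chain rule is a substitution.\<close>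

lemma complex_differentiable_at_iff_slopes:
  assumes a: "a \<in> Cn n"
  shows "complex_differentiable_at n f a \<longleftrightarrow>
    (\<exists>g. eventually (\<lambda>z. f z - f a = (\<Sum>i<n. g i z * (z i - a i))) (nhdsin (ctop n) a) \<and>
         (\<forall>i<n. (g i \<longlongrightarrow> g i a) (nhdsin (ctop n) a)))"
    (is "_ \<longleftrightarrow> ?R")
proof
  let ?N = "\<lambda>z. L2_set (\<lambda>i. cmod (z i - a i)) {..<n}"
  have N0: "z = a" if "?N z = 0" "z \<in> Cn n" for z
  proof
    fix i show "z i = a i"
      using that a by (cases "i < n") (auto simp: L2_set_eq_0_iff Cn_def)
  qed
  have N_le: "cmod (z i - a i) \<le> ?N z" if "i < n" for z i
    using member_le_L2_set[of "{..<n}" i "\<lambda>i. cmod (z i - a i)"] that by simp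
  {
    assume "complex_differentiable_at n f a"
    then obtain c where c: "((\<lambda>z. (f z - f a - (\<Sum>i<n. c i * (z i - a i))) / of_real (?N z)) \<longlongrightarrow> 0)
        (at a within Cn n)"
      by (auto simp: complex_differentiable_at_def)
    define e where "e = (\<lambda>z. (f z - f a - (\<Sum>i<n. c i * (z i - a i))) / of_real (?N z))"
    \<comment> \<open>At \<open>a\<close> the quotient is 0/0, which is 0 by convention; the limit
      over punctured neighbourhoods thus extends to full ones.\<close>
    have ea: "e a = 0" by (simp add: e_def)
    have e: "(e \<longlongrightarrow> 0) (nhdsin (ctop n) a)"
      using c ea unfolding e_def[symmetric] nhdsin_top_of_set[OF a]
      by (metis tendsto_at_iff_tendsto_nhds_within at_within_def)
    \<comment> \<open>The remainder \<open>e z * N\<close> is distributed over the coordinates: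
      weighted by \<open>z i - a i\<close>, the conjugates \<open>cnj (z i - a i) / N\<close> add up
      to N, so the slope formula becomes exact. Each conjugate quotient has modulus at most 1, so
      the slopes still tend to \<open>c i\<close>.\<close>
    define g where "g = (\<lambda>i z. c i + e z * (cnj (z i - a i) / of_real (?N z)))"
    have "f z - f a = (\<Sum>i<n. g i z * (z i - a i))" if z: "z \<in> Cn n" for z
    proof (cases "z = a")
      case False
      then have N: "?N z \<noteq> 0" using N0 z by blast
      have sq: "(\<Sum>i<n. cnj (z i - a i) * (z i - a i)) = of_real ((?N z)\<^sup>2)"
        unfolding L2_set_def real_sqrt_pow2[OF sum_nonneg[OF zero_le_power2]] of_real_sum complex_norm_square
        by (simp add: mult.commute)
      have "(\<Sum>i<n. g i z * (z i - a i)) = (\<Sum>i<n. c i * (z i - a i)) +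
          (\<Sum>i<n. e z / of_real (?N z) * (cnj (z i - a i) * (z i - a i)))"
        by (simp add: g_def distrib_right mult.assoc del: complex_cnj_diff flip: sum.distrib)
      also have "(\<Sum>i<n. e z / of_real (?N z) * (cnj (z i - a i) * (z i - a i))) = e z * of_real (?N z)"
        unfolding sum_distrib_left[symmetric] sq using N by (simp add: power2_eq_square)
      also have "\<dots> = f z - f a - (\<Sum>i<n. c i * (z i - a i))"
        using N by (simp add: e_def)
      finally show ?thesis by simp
    qed simp
    moreover have "(g i \<longlongrightarrow> g i a) (nhdsin (ctop n) a)" if "i < n" for i
    proof -
      have "((\<lambda>z. e z * (cnj (z i - a i) / of_real (?N z))) \<longlongrightarrow> 0) (nhdsin (ctop n) a)"
      proof (rule Lim_null_comparison[OF _ tendsto_norm_zero[OF e]], rule always_eventually, rule allI)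
        fix z
        have "cmod (cnj (z i - a i) / of_real (?N z)) = cmod (z i - a i) / ?N z"
          by (simp only: norm_divide complex_mod_cnj norm_of_real abs_of_nonneg[OF L2_set_nonneg])
        also have "\<dots> \<le> 1"
          using N_le[OF that, of z] L2_set_nonneg[of "\<lambda>i. cmod (z i - a i)" "{..<n}"]
          by (metis divide_le_eq_1 order_le_less)
        finally have "cmod (cnj (z i - a i) / of_real (?N z)) \<le> 1" .
        then show "cmod (e z * (cnj (z i - a i) / of_real (?N z))) \<le> cmod (e z)"
          unfolding norm_mult by (simp add: mult_left_le)
      qed
      from tendsto_add[OF tendsto_const[of "c i"] this] show ?thesis
        by (simp add: g_def)
    qed
    ultimately show ?R
      using a by (intro exI[of _ g] conjI eventually_nhdsinI[of _ "Cn n"]) auto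
  next
    assume ?R
    then obtain g where g: "eventually (\<lambda>z. f z - f a = (\<Sum>i<n. g i z * (z i - a i))) (nhdsin (ctop n) a)"
      and gl: "\<And>i. i < n \<Longrightarrow> (g i \<longlongrightarrow> g i a) (nhdsin (ctop n) a)"
      by blast
    let ?e = "\<lambda>z. (f z - f a - (\<Sum>i<n. g i a * (z i - a i))) / of_real (?N z)"
    \<comment> \<open>With the slopes frozen at \<open>a\<close>, the bound
      \<open>|z i - a i| \<le> N\<close> absorbs the denominator; where N is 0, the quotient is 0 by
      convention.\<close>
    have le: "cmod (?e z) \<le> (\<Sum>i<n. cmod (g i z - g i a))" if z: "f z - f a = (\<Sum>i<n. g i z * (z i - a i))" for z
    proof (cases "?N z = 0")
      case False
      then have N: "?N z > 0" by (simp add: order_less_le)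
      have "f z - f a - (\<Sum>i<n. g i a * (z i - a i)) = (\<Sum>i<n. (g i z - g i a) * (z i - a i))"
        by (simp add: z left_diff_distrib sum_subtractf)
      also have "cmod \<dots> \<le> (\<Sum>i<n. cmod (g i z - g i a) * ?N z)"
        by (intro order_trans[OF norm_sum] sum_mono) (simp add: norm_mult mult_left_mono N_le)
      finally show ?thesis
        using N by (simp add: norm_divide divide_le_eq flip: sum_distrib_right)
    qed (simp add: sum_nonneg)
    have "((\<lambda>z. \<Sum>i<n. cmod (g i z - g i a)) \<longlongrightarrow> (\<Sum>i<n. cmod (g i a - g i a))) (nhdsin (ctop n) a)"
      by (intro tendsto_sum tendsto_norm tendsto_diff tendsto_const gl) auto
    then have "(?e \<longlongrightarrow> 0) (nhdsin (ctop n) a)"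
      by (intro Lim_null_comparison[OF eventually_mono[OF g le]]) simp_all
    then have "(?e \<longlongrightarrow> 0) (at a within Cn n)"
      by (rule tendsto_mono[rotated]) (auto simp: nhdsin_top_of_set[OF a] at_within_def intro: inf_mono le_infI2)
    then show "complex_differentiable_at n f a"
      unfolding complex_differentiable_at_def by (rule exI[of _ "\<lambda>i. g i a"])
  }
qed

lemma complex_differentiable_at_imp_tendsto:
  assumes "complex_differentiable_at n f a" and a: "a \<in> Cn n"
  shows "(f \<longlongrightarrow> f a) (nhdsin (ctop n) a)"
proof -
  obtain g where g: "eventually (\<lambda>z. f z - f a = (\<Sum>i<n. g i z * (z i - a i))) (nhdsin (ctop n) a)"
    and gl: "\<And>i. i < n \<Longrightarrow> (g i \<longlongrightarrow> g i a) (nhdsin (ctop n) a)"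
    using assms(1) unfolding complex_differentiable_at_iff_slopes[OF a] by blast
  have "((\<lambda>z. f a + (\<Sum>i<n. g i z * (z i - a i))) \<longlongrightarrow> f a + (\<Sum>i<n. g i a * (a i - a i)))
      (nhdsin (ctop n) a)"
    by (intro tendsto_intros gl tendsto_coordinate a) auto
  moreover have "eventually (\<lambda>z. f a + (\<Sum>i<n. g i z * (z i - a i)) = f z) (nhdsin (ctop n) a)"
    using g by eventually_elim (metis add_diff_cancel_left' diff_add_cancel add.commute)
  ultimately show ?thesis using tendsto_cong by fastforce
qed

text \<open>The slopes of the composite are the matrix product of the two families,
  \<open>\<Sum>j<m. g j (\<phi> z) * h j i z\<close>. Continuity of \<open>\<phi>\<close> as a map
  into \<open>Cn m\<close> carries the slope formula and the limits of \<open>g\<close> from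
  \<open>\<phi> a\<close> back to \<open>a\<close>.\<close>

lemma complex_differentiable_at_compose:
  assumes f: "complex_differentiable_at m f (\<phi> a)"
    and \<phi>: "\<And>i. i < m \<Longrightarrow> complex_differentiable_at n (\<lambda>z. \<phi> z i) a"
    and a: "a \<in> Cn n" and ev: "eventually (\<lambda>z. \<phi> z \<in> Cn m) (nhdsin (ctop n) a)"
  shows "complex_differentiable_at n (\<lambda>z. f (\<phi> z)) a"
proof -
  have b: "\<phi> a \<in> Cn m" using eventually_nhdsin_self[OF ev] a by simp
  obtain g where g: "eventually (\<lambda>w. f w - f (\<phi> a) = (\<Sum>j<m. g j w * (w j - \<phi> a j)))
        (nhdsin (ctop m) (\<phi> a))"
    and gl: "\<And>j. j < m \<Longrightarrow> (g j \<longlongrightarrow> g j (\<phi> a)) (nhdsin (ctop m) (\<phi> a))"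
    using f unfolding complex_differentiable_at_iff_slopes[OF b] by blast
  have "\<forall>j\<in>{..<m}. \<exists>h.
      eventually (\<lambda>z. \<phi> z j - \<phi> a j = (\<Sum>i<n. h i z * (z i - a i))) (nhdsin (ctop n) a) \<and>
      (\<forall>i<n. (h i \<longlongrightarrow> h i a) (nhdsin (ctop n) a))"
    using \<phi> by (auto simp only: complex_differentiable_at_iff_slopes[OF a] lessThan_iff)
  from bchoice[OF this] obtain h where h: "\<And>j. j < m \<Longrightarrow>
        eventually (\<lambda>z. \<phi> z j - \<phi> a j = (\<Sum>i<n. h j i z * (z i - a i))) (nhdsin (ctop n) a)"
    and hl: "\<And>i j. j < m \<Longrightarrow> i < n \<Longrightarrow> (h j i \<longlongrightarrow> h j i a) (nhdsin (ctop n) a)"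
    by auto
  have lim: "filterlim \<phi> (nhdsin (ctop m) (\<phi> a)) (nhdsin (ctop n) a)"
    using \<phi> complex_differentiable_at_imp_tendsto[OF _ a] b ev
    by (fastforce simp: filterlim_nhdsin_ctop_iff)
  have "eventually (\<lambda>z. \<forall>j\<in>{..<m}. \<phi> z j - \<phi> a j = (\<Sum>i<n. h j i z * (z i - a i)))
      (nhdsin (ctop n) a)"
    using h by (auto simp: eventually_ball_finite_distrib)
  moreover have "eventually (\<lambda>z. f (\<phi> z) - f (\<phi> a) = (\<Sum>j<m. g j (\<phi> z) * (\<phi> z j - \<phi> a j)))
      (nhdsin (ctop n) a)"
    using filterlim_iff lim g by blast
  ultimately have "eventually (\<lambda>z. f (\<phi> z) - f (\<phi> a) =
      (\<Sum>i<n. (\<Sum>j<m. g j (\<phi> z) * h j i z) * (z i - a i))) (nhdsin (ctop n) a)"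
  proof eventually_elim
    case (elim z)
    have "(\<Sum>j<m. g j (\<phi> z) * (\<phi> z j - \<phi> a j)) =
        (\<Sum>j<m. \<Sum>i<n. g j (\<phi> z) * h j i z * (z i - a i))"
      using elim(1) by (auto simp: sum_distrib_left mult.assoc intro!: sum.cong)
    also have "\<dots> = (\<Sum>i<n. (\<Sum>j<m. g j (\<phi> z) * h j i z) * (z i - a i))"
      by (subst sum.swap) (simp add: sum_distrib_right)
    finally show ?case using elim(2) by simp
  qed
  moreover have "((\<lambda>z. \<Sum>j<m. g j (\<phi> z) * h j i z) \<longlongrightarrow> (\<Sum>j<m. g j (\<phi> a) * h j i a))
      (nhdsin (ctop n) a)" if "i < n" for i
    using that by (intro tendsto_sum tendsto_mult hl filterlim_compose[OF gl lim]) auto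
  ultimately show ?thesis
    unfolding complex_differentiable_at_iff_slopes[OF a]
    by (intro exI[of _ "\<lambda>i z. \<Sum>j<m. g j (\<phi> z) * h j i z"]) auto
qed

text \<open>The slopes are the constants \<open>d i\<close>. Constants, coordinates and the
  difference of two coordinates are all of this form.\<close>

lemma complex_differentiable_at_affine:
  assumes a: "a \<in> Cn n"
  shows "complex_differentiable_at n (\<lambda>z. c + (\<Sum>i<n. d i * z i)) a"
  unfolding complex_differentiable_at_iff_slopes[OF a]
  by (intro exI[of _ "\<lambda>i z. d i"])
     (simp add: right_diff_distrib sum_subtractf)

lemma hol_near_imp_tendsto:
  "hol_near n f a \<Longrightarrow> (f \<longlongrightarrow> f a) (nhdsin (ctop n) a)"
  by (auto simp: hol_near_def intro: complex_differentiable_at_imp_tendsto dest: eventually_nhdsin_self)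

lemma hol_near_imp_filterlim:
  assumes "a \<in> Cn n" "eventually (\<lambda>z. \<phi> z \<in> Cn m) (nhdsin (ctop n) a)"
    and "\<And>i. i < m \<Longrightarrow> hol_near n (\<lambda>z. \<phi> z i) a"
  shows "filterlim \<phi> (nhdsin (ctop m) (\<phi> a)) (nhdsin (ctop n) a)"
  using assms hol_near_imp_tendsto eventually_nhdsin_self[OF assms(2)]
  by (fastforce simp: filterlim_nhdsin_ctop_iff)

text \<open>Agreement near \<open>a\<close> is also agreement near each point \<open>z\<close> close
  to \<open>a\<close>, so the slopes of \<open>f\<close> at \<open>z\<close> serve for
  \<open>g\<close>.\<close>

lemma hol_near_cong:
  assumes "hol_near n f a" and "eventually (\<lambda>z. g z = f z) (nhdsin (ctop n) a)"
  shows "hol_near n g a"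
proof -
  have a: "a \<in> Cn n" using assms(1) by (simp add: hol_near_def)
  have dom: "eventually (\<lambda>z. z \<in> Cn n) (nhdsin (ctop n) a)"
    using a by (intro eventually_nhdsinI[of _ "Cn n"]) auto
  have "eventually (\<lambda>z. complex_differentiable_at n f z) (nhdsin (ctop n) a)"
    using assms(1) by (simp add: hol_near_def)
  from this eventually_eventually_nhdsin[OF assms(2)] dom
  have "eventually (\<lambda>z. complex_differentiable_at n g z) (nhdsin (ctop n) a)"
  proof eventually_elim
    case (elim z)
    have gz: "g z = f z" using eventually_nhdsin_self[OF elim(2)] elim(3) by simp
    obtain s where "eventually (\<lambda>w. f w - f z = (\<Sum>i<n. s i w * (w i - z i))) (nhdsin (ctop n) z)"
      and s: "\<forall>i<n. (s i \<longlongrightarrow> s i z) (nhdsin (ctop n) z)"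
      using elim(1) unfolding complex_differentiable_at_iff_slopes[OF elim(3)] by blast
    from this(1) elim(2)
    have "eventually (\<lambda>w. g w - g z = (\<Sum>i<n. s i w * (w i - z i))) (nhdsin (ctop n) z)"
      by eventually_elim (simp add: gz)
    with s show ?case
      using complex_differentiable_at_iff_slopes[OF elim(3)] by blast
  qed
  with a show ?thesis by (simp add: hol_near_def)
qed

text \<open>Every hypothesis at \<open>a\<close> persists at nearby points, where the pointwise
  chain rule is applied.\<close>

lemma hol_near_compose:
  assumes f: "hol_near m f (\<phi> a)" and a: "a \<in> Cn n"
    and ev: "eventually (\<lambda>z. \<phi> z \<in> Cn m) (nhdsin (ctop n) a)"
    and \<phi>: "\<And>i. i < m \<Longrightarrow> hol_near n (\<lambda>z. \<phi> z i) a"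
  shows "hol_near n (\<lambda>z. f (\<phi> z)) a"
proof -
  have lim: "filterlim \<phi> (nhdsin (ctop m) (\<phi> a)) (nhdsin (ctop n) a)"
    using hol_near_imp_filterlim[OF a ev \<phi>] .
  have "eventually (\<lambda>z. complex_differentiable_at m f (\<phi> z)) (nhdsin (ctop n) a)"
    using f lim by (auto simp: hol_near_def filterlim_iff)
  moreover have "eventually (\<lambda>z. \<forall>i\<in>{..<m}. complex_differentiable_at n (\<lambda>z. \<phi> z i) z)
      (nhdsin (ctop n) a)"
    using \<phi> by (auto simp: eventually_ball_finite_distrib hol_near_def)
  moreover have "eventually (\<lambda>z. z \<in> Cn n) (nhdsin (ctop n) a)"
    using a by (intro eventually_nhdsinI[of _ "Cn n"]) auto
  moreover note eventually_eventually_nhdsin[OF ev]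
  ultimately have "eventually (\<lambda>z. complex_differentiable_at n (\<lambda>z. f (\<phi> z)) z) (nhdsin (ctop n) a)"
    by eventually_elim (rule complex_differentiable_at_compose, auto)
  with a show ?thesis by (simp add: hol_near_def)
qed

lemma hol_near_affine:
  assumes "a \<in> Cn n"
  shows "hol_near n (\<lambda>z. c + (\<Sum>i<n. d i * z i)) a"
  using assms unfolding hol_near_def
  by (auto intro!: eventually_nhdsinI[of _ "Cn n"] complex_differentiable_at_affine)

lemma hol_near_const: "a \<in> Cn n \<Longrightarrow> hol_near n (\<lambda>z. c) a"
  using hol_near_affine[of a n c "\<lambda>_. 0"] by simp

lemma hol_near_coordinate: "a \<in> Cn n \<Longrightarrow> i < n \<Longrightarrow> hol_near n (\<lambda>z. z i) a"
  using hol_near_affine[of a n 0 "\<lambda>j. if j = i then 1 else 0"]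
  by (simp add: if_distrib[of "\<lambda>c. c * _"] cong: if_cong)

lemma hol_near_diff:
  assumes "hol_near n f a" "hol_near n g a"
  shows "hol_near n (\<lambda>z. f z - g z) a"
proof -
  \<comment> \<open>The pair (f, g) as a map into C^2, padded with zeros; the difference is its
    composite with the affine function \<open>w 0 - w 1\<close>.\<close>
  define \<phi> where "\<phi> = (\<lambda>z i. if i = 0 then f z else if i = (1::nat) then g z else 0)"
  have a: "a \<in> Cn n" using assms by (simp add: hol_near_def)
  have \<phi>C: "\<phi> z \<in> Cn 2" for z by (auto simp: \<phi>_def Cn_def)
  have "hol_near 2 (\<lambda>w. w 0 - w 1) (\<phi> a)"
    using hol_near_affine[OF \<phi>C, of 0 "\<lambda>i. if i = 0 then 1 else -1" a]
    by (simp add: numeral_2_eq_2)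
  moreover have "hol_near n (\<lambda>z. \<phi> z i) a" if "i < 2" for i
    using assms that by (auto simp: \<phi>_def less_2_cases_iff)
  ultimately have "hol_near n (\<lambda>z. \<phi> z 0 - \<phi> z 1) a"
    by (intro hol_near_compose[of 2 "\<lambda>w. w 0 - w 1" \<phi> a n]) (auto simp: a \<phi>C)
  then show ?thesis by (simp add: \<phi>_def)
qed

section \<open>Holomorphic functions and maps on manifolds\<close>

lemma nhdsin_subtopology_open:
  assumes "openin T U" "a \<in> U"
  shows "nhdsin (subtopology T U) a = nhdsin T a"
proof (rule filter_eqI)
  fix P
  have a: "a \<in> topspace T" using assms openin_subset by blast
  have "(\<exists>V. openin T V \<and> V \<subseteq> U \<and> a \<in> V \<and> (\<forall>x\<in>V. P x)) \<longleftrightarrow>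
      (\<exists>V. openin T V \<and> a \<in> V \<and> (\<forall>x\<in>V. P x))"
    using assms by (metis Int_iff inf_le2 openin_Int)
  then show "eventually P (nhdsin (subtopology T U) a) \<longleftrightarrow> eventually P (nhdsin T a)"
    using assms a by (simp add: eventually_nhdsin openin_open_subtopology conj_assoc)
qed

lemma continuous_map_filterlim_nhdsin:
  assumes f: "continuous_map T T' f" and a: "a \<in> topspace T"
  shows "filterlim f (nhdsin T' (f a)) (nhdsin T a)"
  unfolding filterlim_iff
proof (intro allI impI)
  fix P assume "eventually P (nhdsin T' (f a))"
  moreover have "f a \<in> topspace T'" using f a by (auto simp: continuous_map_def)
  ultimately obtain V where V: "openin T' V" "f a \<in> V" "\<And>y. y \<in> V \<Longrightarrow> P y"
    by (auto simp: eventually_nhdsin)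
  show "eventually (\<lambda>x. P (f x)) (nhdsin T a)"
    using V a openin_continuous_map_preimage[OF f V(1)]
    by (intro eventually_nhdsinI[of _ "{x \<in> topspace T. f x \<in> V}"]) auto
qed

lemma continuous_map_on_open_filterlim:
  assumes "continuous_map (subtopology T U) T' f" "openin T U" "a \<in> U"
  shows "filterlim f (nhdsin T' (f a)) (nhdsin T a)"
proof -
  have "a \<in> topspace (subtopology T U)"
    using assms(2,3) openin_subset by fastforce
  from continuous_map_filterlim_nhdsin[OF assms(1) this] show ?thesis
    by (simp add: nhdsin_subtopology_open[OF assms(2,3)])
qed

text \<open>Charts enter later arguments through these facts: a chart and its inverse become limits
  of neighbourhood filters, between the manifold and \<open>Cn\<close>.\<close>

lemma
  assumes M: "complex_manifold M" and c: "(U, \<phi>) \<in> charts_of M" and p: "p \<in> U"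
  shows chart_open: "opn M U"
    and chart_in_Cn: "\<phi> p \<in> Cn (dim_of M)"
    and chart_inj: "inj_on \<phi> U"
    and chart_filterlim: "filterlim \<phi> (nhdsin (ctop (dim_of M)) (\<phi> p)) (nhdsin (top_of M) p)"
    and chart_inv_filterlim:
      "filterlim (inv_into U \<phi>) (nhdsin (top_of M) p) (nhdsin (ctop (dim_of M)) (\<phi> p))"
proof -
  let ?n = "dim_of M"
  show U: "opn M U"
    using M c by (auto simp: complex_manifold_def)
  have V: "openin (ctop ?n) (\<phi> ` U)"
    using M c by (auto simp: complex_manifold_def)
  have hom: "homeomorphic_map (subtopology (top_of M) U) (top_of_set (\<phi> ` U)) \<phi>"
    using M c by (auto simp: complex_manifold_def)
  have VC: "\<phi> ` U \<subseteq> Cn ?n" using openin_subset[OF V] by simp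
  then show "\<phi> p \<in> Cn ?n" using p by auto
  have UT: "topspace (subtopology (top_of M) U) = U"
    using openin_subset[OF U] by auto
  show inj: "inj_on \<phi> U"
    using homeomorphic_imp_injective_map[OF hom] UT by simp
  \<comment> \<open>The atlas gives the image of a chart the topology of the space of all sequences;
    it must be reread as an open subspace of \<open>ctop\<close>, whose neighbourhoods occur in
    \<open>hol_near\<close>.\<close>
  have VT: "top_of_set (\<phi> ` U) = subtopology (ctop ?n) (\<phi> ` U)"
    using VC by (simp add: subtopology_subtopology inf.absorb2)
  have "continuous_map (subtopology (top_of M) U) (subtopology (ctop ?n) (\<phi> ` U)) \<phi>"
    using homeomorphic_imp_continuous_map[OF hom] VT by simp
  from continuous_map_on_open_filterlim[OF this U p]
  show "filterlim \<phi> (nhdsin (ctop ?n) (\<phi> p)) (nhdsin (top_of M) p)"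
    using nhdsin_subtopology_open[OF V] p by simp
  obtain g where g: "homeomorphic_maps (subtopology (top_of M) U) (top_of_set (\<phi> ` U)) \<phi> g"
    using hom homeomorphic_map_maps by blast
  \<comment> \<open>The continuous inverse \<open>g\<close> agrees with \<open>inv_into\<close> on
    the image of the chart, which is a neighbourhood of \<open>\<phi> p\<close>.\<close>
  have gi: "g z = inv_into U \<phi> z" if "z \<in> \<phi> ` U" for z
  proof -
    obtain u where u: "u \<in> U" "z = \<phi> u" using \<open>z \<in> \<phi> ` U\<close> by blast
    then have "g (\<phi> u) = u" using g UT unfolding homeomorphic_maps_def by blast
    then show ?thesis using u inj by simp
  qed
  have cg: "continuous_map (top_of_set (\<phi> ` U)) (subtopology (top_of M) U) g"
    using g unfolding homeomorphic_maps_def by blast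
  have "continuous_map (subtopology (ctop ?n) (\<phi> ` U)) (subtopology (top_of M) U) (inv_into U \<phi>)"
    unfolding VT[symmetric] by (rule continuous_map_eq[OF cg]) (simp add: gi)
  then have "continuous_map (subtopology (ctop ?n) (\<phi> ` U)) (top_of M) (inv_into U \<phi>)"
    by (simp add: continuous_map_in_subtopology)
  from continuous_map_on_open_filterlim[OF this V, of "\<phi> p"]
  show "filterlim (inv_into U \<phi>) (nhdsin (top_of M) p) (nhdsin (ctop ?n) (\<phi> p))"
    using p inj by simp
qed

lemma chart_exists:
  assumes "complex_manifold M" "p \<in> points M"
  obtains U \<phi> where "(U, \<phi>) \<in> charts_of M" "p \<in> U"
proof -
  have "p \<in> (\<Union>(U, \<phi>)\<in>charts_of M. U)"
    using assms by (simp add: complex_manifold_def)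
  then show ?thesis using that by blast
qed

lemma eventually_chart_inv:
  assumes M: "complex_manifold M" and c: "(U, \<phi>) \<in> charts_of M" "p \<in> U"
    and P: "eventually P (nhdsin (top_of M) p)"
  shows "eventually (\<lambda>z. P (inv_into U \<phi> z)) (nhdsin (ctop (dim_of M)) (\<phi> p))"
  using chart_inv_filterlim[OF M c] P unfolding filterlim_iff by blast

lemma hol_atD:
  "hol_at M f p \<Longrightarrow> (U, \<phi>) \<in> charts_of M \<Longrightarrow> p \<in> U \<Longrightarrow>
    hol_near (dim_of M) (\<lambda>z. f (inv_into U \<phi> z)) (\<phi> p)"
  by (auto simp: hol_at_def)

lemma hol_at_imp_tendsto:
  assumes M: "complex_manifold M" and f: "hol_at M f p"
  shows "(f \<longlongrightarrow> f p) (nhdsin (top_of M) p)"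
proof -
  have "p \<in> points M" using f by (simp add: hol_at_def)
  then obtain U \<phi> where c: "(U, \<phi>) \<in> charts_of M" "p \<in> U"
    using chart_exists[OF M] by blast
  note inj = chart_inj[OF M c]
  have "((\<lambda>r. f (inv_into U \<phi> (\<phi> r))) \<longlongrightarrow> f (inv_into U \<phi> (\<phi> p))) (nhdsin (top_of M) p)"
    using filterlim_compose[OF hol_near_imp_tendsto[OF hol_atD[OF f c]] chart_filterlim[OF M c]] .
  moreover have "eventually (\<lambda>r. f (inv_into U \<phi> (\<phi> r)) = f r) (nhdsin (top_of M) p)"
    using chart_open[OF M c] c(2) inj by (intro eventually_nhdsinI[of _ U]) auto
  ultimately show ?thesis
    using inj c(2) by (simp add: tendsto_cong)
qed

text \<open>Holomorphy on a manifold refers to every chart at the point. In each of them the claim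
  is the composition rule in C^n for \<open>k\<close> read in that chart.\<close>

lemma hol_at_compose_hol_near:
  assumes M: "complex_manifold M" and p: "p \<in> points M"
    and f: "hol_near m f (k p)" and ev: "eventually (\<lambda>r. k r \<in> Cn m) (nhdsin (top_of M) p)"
    and k: "\<And>i. i < m \<Longrightarrow> hol_at M (\<lambda>r. k r i) p"
  shows "hol_at M (\<lambda>r. f (k r)) p"
proof -
  have "hol_near (dim_of M) (\<lambda>z. f (k (inv_into U \<phi> z))) (\<phi> p)"
    if c: "(U, \<phi>) \<in> charts_of M" "p \<in> U" for U \<phi>
  proof (rule hol_near_compose[where \<phi> = "\<lambda>z. k (inv_into U \<phi> z)"])
    show "hol_near m f (k (inv_into U \<phi> (\<phi> p)))"
      using f chart_inj[OF M c] c by simp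
    show "hol_near (dim_of M) (\<lambda>z. k (inv_into U \<phi> z) i) (\<phi> p)" if "i < m" for i
      using hol_atD[OF k[OF that] c] .
  qed (use chart_in_Cn[OF M c] eventually_chart_inv[OF M c ev] in auto)
  with p show ?thesis unfolding hol_at_def by blast
qed

lemma holomorphic_map_filterlim:
  assumes "holomorphic_map_on M N U h" "p \<in> U"
  shows "filterlim h (nhdsin (top_of N) (h p)) (nhdsin (top_of M) p)"
  using assms by (auto simp: holomorphic_map_on_def intro: continuous_map_on_open_filterlim)

text \<open>In charts the composite is \<open>f\<close> after the inverse of \<open>\<psi>\<close>,
  preceded by the coordinate expression of \<open>h\<close>. Inserting \<open>\<psi>\<close> and its
  inverse is legitimate only where \<open>h\<close> lands in \<open>W\<close>, whence the passage
  through \<open>hol_near_cong\<close>.\<close>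

lemma hol_at_compose_holomorphic_map:
  assumes M: "complex_manifold M" and N: "complex_manifold N"
    and h: "holomorphic_map_on M N U h" and p: "p \<in> U" and f: "hol_at N f (h p)"
  shows "hol_at M (\<lambda>r. f (h r)) p"
  unfolding hol_at_def
proof (intro conjI, goal_cases)
  case 1
  show ?case using h p openin_subset unfolding holomorphic_map_on_def by blast
next
  case 2
  show ?case
  proof clarify
    fix V \<phi> assume c: "(V, \<phi>) \<in> charts_of M" "p \<in> V"
    have "h p \<in> points N" using f by (simp add: hol_at_def)
    then obtain W \<psi> where d: "(W, \<psi>) \<in> charts_of N" "h p \<in> W"
      using chart_exists[OF N] by blast
    let ?k = "\<lambda>z. \<psi> (h (inv_into V \<phi> z))"
    have hW: "eventually (\<lambda>r. h r \<in> W) (nhdsin (top_of M) p)"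
      using holomorphic_map_filterlim[OF h p] eventually_nhdsinI[OF chart_open[OF N d] d(2), of "\<lambda>r. r \<in> W"]
      unfolding filterlim_iff by blast
    note ev = eventually_chart_inv[OF M c hW]
    have pp: "inv_into V \<phi> (\<phi> p) = p" using chart_inj[OF M c] c by simp
    have hol: "hol_near (dim_of N) (\<lambda>w. f (inv_into W \<psi> w)) (?k (\<phi> p))"
      using hol_atD[OF f d] by (simp add: pp)
    have "hol_near (dim_of M) (\<lambda>z. f (inv_into W \<psi> (?k z))) (\<phi> p)"
    proof (rule hol_near_compose[where \<phi> = ?k, OF hol chart_in_Cn[OF M c]])
      show "eventually (\<lambda>z. ?k z \<in> Cn (dim_of N)) (nhdsin (ctop (dim_of M)) (\<phi> p))"
        using ev by eventually_elim (rule chart_in_Cn[OF N d(1)])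
      show "hol_near (dim_of M) (\<lambda>z. ?k z i) (\<phi> p)" if "i < dim_of N" for i
        using h p c d that unfolding holomorphic_map_on_def by blast
    qed
    then show "hol_near (dim_of M) (\<lambda>z. f (h (inv_into V \<phi> z))) (\<phi> p)"
      by (rule hol_near_cong)
         (rule eventually_mono[OF ev], simp add: inv_into_f_f[OF chart_inj[OF N d]])
  qed
qed

section \<open>Germs of maps\<close>

lemma germ_eq_iff: "germ T x f = germ T x g \<longleftrightarrow> eventually (\<lambda>p. f p = g p) (nhdsin T x)"
proof
  assume "germ T x f = germ T x g"
  moreover have "f \<in> germ T x f" by (simp add: germ_def)
  ultimately show "eventually (\<lambda>p. f p = g p) (nhdsin T x)" by (auto simp: germ_def)
next
  assume fg: "eventually (\<lambda>p. f p = g p) (nhdsin T x)"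
  have "eventually (\<lambda>p. k p = f p) (nhdsin T x) \<longleftrightarrow> eventually (\<lambda>p. k p = g p) (nhdsin T x)" for k
    by (rule eventually_cong[OF fg]) simp
  then show "germ T x f = germ T x g" by (simp add: germ_def)
qed

lemma germ_self: "f \<in> germ T x f"
  by (simp add: germ_def)

text \<open>\<open>germ_comp\<close> collects composites of all representatives. The limit
  hypothesis brings values of the inner map to where two outer representatives agree, so the
  composites form one germ.\<close>

lemma germ_comp_germ:
  assumes "filterlim h (nhdsin T' y) (nhdsin T x)"
  shows "germ_comp T x (germ T' y g) (germ T x h) = germ T x (\<lambda>p. g (h p))"
proof -
  have "eventually (\<lambda>p. k p = g (h p)) (nhdsin T x)"
    if "eventually (\<lambda>p. k p = g' (h' p)) (nhdsin T x)" "eventually (\<lambda>w. g' w = g w) (nhdsin T' y)"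
      "eventually (\<lambda>p. h' p = h p) (nhdsin T x)" for k g' h'
  proof -
    have "eventually (\<lambda>p. g' (h p) = g (h p)) (nhdsin T x)"
      using assms that(2) unfolding filterlim_iff by blast
    with that(1,3) show ?thesis by eventually_elim simp
  qed
  then have "germ_comp T x (germ T' y g) (germ T x h) \<subseteq> germ T x (\<lambda>p. g (h p))"
    unfolding germ_comp_def germ_def by blast
  moreover have "germ T x (\<lambda>p. g (h p)) \<subseteq> germ_comp T x (germ T' y g) (germ T x h)"
    using germ_self[of g T' y] germ_self[of h T x] unfolding germ_comp_def germ_def[of T x "\<lambda>p. g (h p)"]
    by blast
  ultimately show ?thesis by blast
qed

section \<open>The kernel of a functor of groupoids\<close>

lemma groupoid_Idn: "groupoid G \<Longrightarrow> x \<in> Obj G \<Longrightarrow> Idn G x \<in> Hom G x x"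
  by (simp add: groupoid_def)

lemma groupoid_Cmp:
  "groupoid G \<Longrightarrow> x \<in> Obj G \<Longrightarrow> y \<in> Obj G \<Longrightarrow> z \<in> Obj G \<Longrightarrow> f \<in> Hom G x y \<Longrightarrow> g \<in> Hom G y z \<Longrightarrow>
    Cmp G x y z g f \<in> Hom G x z"
  unfolding groupoid_def by blast

lemma groupoid_idr:
  "groupoid G \<Longrightarrow> x \<in> Obj G \<Longrightarrow> y \<in> Obj G \<Longrightarrow> f \<in> Hom G x y \<Longrightarrow> Cmp G x x y f (Idn G x) = f"
  unfolding groupoid_def by blast

lemma groupoid_idl:
  "groupoid G \<Longrightarrow> x \<in> Obj G \<Longrightarrow> y \<in> Obj G \<Longrightarrow> f \<in> Hom G x y \<Longrightarrow> Cmp G x y y (Idn G y) f = f"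
  unfolding groupoid_def by blast

lemma groupoid_assoc:
  "groupoid G \<Longrightarrow> w \<in> Obj G \<Longrightarrow> x \<in> Obj G \<Longrightarrow> y \<in> Obj G \<Longrightarrow> z \<in> Obj G \<Longrightarrow>
    f \<in> Hom G w x \<Longrightarrow> g \<in> Hom G x y \<Longrightarrow> h \<in> Hom G y z \<Longrightarrow>
    Cmp G w x z (Cmp G x y z h g) f = Cmp G w y z h (Cmp G w x y g f)"
  unfolding groupoid_def by blast

lemma groupoid_inverse:
  assumes "groupoid G" "x \<in> Obj G" "y \<in> Obj G" "f \<in> Hom G x y"
  obtains g where "inverse_arrows G x y f g"
  using assms unfolding groupoid_def by blast

lemma groupoidI:
  assumes "\<And>x. x \<in> Obj G \<Longrightarrow> Idn G x \<in> Hom G x x"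
    and "\<And>x y z f g. x \<in> Obj G \<Longrightarrow> y \<in> Obj G \<Longrightarrow> z \<in> Obj G \<Longrightarrow> f \<in> Hom G x y \<Longrightarrow> g \<in> Hom G y z \<Longrightarrow>
      Cmp G x y z g f \<in> Hom G x z"
    and "\<And>x y f. x \<in> Obj G \<Longrightarrow> y \<in> Obj G \<Longrightarrow> f \<in> Hom G x y \<Longrightarrow> Cmp G x x y f (Idn G x) = f"
    and "\<And>x y f. x \<in> Obj G \<Longrightarrow> y \<in> Obj G \<Longrightarrow> f \<in> Hom G x y \<Longrightarrow> Cmp G x y y (Idn G y) f = f"
    and "\<And>w x y z f g h. w \<in> Obj G \<Longrightarrow> x \<in> Obj G \<Longrightarrow> y \<in> Obj G \<Longrightarrow> z \<in> Obj G \<Longrightarrow>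
      f \<in> Hom G w x \<Longrightarrow> g \<in> Hom G x y \<Longrightarrow> h \<in> Hom G y z \<Longrightarrow>
      Cmp G w x z (Cmp G x y z h g) f = Cmp G w y z h (Cmp G w x y g f)"
    and "\<And>x y f. x \<in> Obj G \<Longrightarrow> y \<in> Obj G \<Longrightarrow> f \<in> Hom G x y \<Longrightarrow> \<exists>g. inverse_arrows G x y f g"
  shows "groupoid G"
  unfolding groupoid_def by (intro conjI ballI assms)

lemma groupoid_functor_inverse:
  assumes E: "groupoid_functor G H Eo E" and x: "x \<in> Obj G" and y: "y \<in> Obj G"
    and fg: "inverse_arrows G x y f g"
  shows "inverse_arrows H (Eo x) (Eo y) (E x y f) (E y x g)"
  using assms unfolding groupoid_functor_def inverse_arrows_def by metis

text \<open>The algebra of the second claim for an arbitrary functor. \<open>K\<close> consists of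
  loops only; this suffices, since two arrows with common endpoints and equal images differ by a
  loop.\<close>

locale functor_kernel =
  fixes G :: "('o, 'm) groupoid_data" and H :: "('p, 'n) groupoid_data"
    and Eo :: "'o \<Rightarrow> 'p" and E :: "'o \<Rightarrow> 'o \<Rightarrow> 'm \<Rightarrow> 'n" and K :: "('o, 'm) groupoid_data"
  defines "K \<equiv> bundle_subgroupoid G (\<lambda>x. {h \<in> Hom G x x. E x x h = Idn H (Eo x)})"
  assumes functor_E: "groupoid_functor G H Eo E"
begin

lemma grpd: "groupoid G" and grpd_H: "groupoid H"
  using functor_E by (auto simp: groupoid_functor_def)

lemma E_obj: "x \<in> Obj G \<Longrightarrow> Eo x \<in> Obj H"
  and E_id: "x \<in> Obj G \<Longrightarrow> E x x (Idn G x) = Idn H (Eo x)"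
  using functor_E by (auto simp: groupoid_functor_def)

lemma E_hom: "x \<in> Obj G \<Longrightarrow> y \<in> Obj G \<Longrightarrow> f \<in> Hom G x y \<Longrightarrow> E x y f \<in> Hom H (Eo x) (Eo y)"
  using functor_E unfolding groupoid_functor_def by blast

lemma E_comp:
  "x \<in> Obj G \<Longrightarrow> y \<in> Obj G \<Longrightarrow> z \<in> Obj G \<Longrightarrow> f \<in> Hom G x y \<Longrightarrow> g \<in> Hom G y z \<Longrightarrow>
    E x z (Cmp G x y z g f) = Cmp H (Eo x) (Eo y) (Eo z) (E y z g) (E x y f)"
  using functor_E unfolding groupoid_functor_def by blast

lemma K_simps [simp]: "Obj K = Obj G" "Idn K = Idn G" "Cmp K = Cmp G"
  by (simp_all add: K_def bundle_subgroupoid_def)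

lemma Hom_K: "Hom K x y = (if x = y then {h \<in> Hom G x x. E x x h = Idn H (Eo x)} else {})"
  by (simp add: K_def bundle_subgroupoid_def)

text \<open>The arrow f' is the composite of \<open>h\<close> with an inverse of \<open>g\<close>.
  Taking an identity for \<open>f\<close> shows that arrows with equal images differ by the kernel;
  a general \<open>f\<close> is needed to decompose an arrow lying over the image of a
  composite.\<close>

lemma divide_left:
  assumes o: "x \<in> Obj G" "y \<in> Obj G" "z \<in> Obj G"
    and g: "g \<in> Hom G y z" and h: "h \<in> Hom G x z" and f: "f \<in> Hom G x y"
    and eq: "E x z h = E x z (Cmp G x y z g f)"
  obtains f' where "f' \<in> Hom G x y" "E x y f' = E x y f" "Cmp G x y z g f' = h"
proof -
  obtain i where i: "inverse_arrows G y z g i"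
    using groupoid_inverse[OF grpd o(2,3) g] .
  have iH: "i \<in> Hom G z y" and gi: "Cmp G z y z g i = Idn G z"
    using i by (auto simp: inverse_arrows_def)
  let ?f = "Cmp G x z y i h"
  have "Cmp G x y z g ?f = h"
    using groupoid_assoc[OF grpd o(1,3,2,3) h iH g] gi groupoid_idl[OF grpd o(1,3) h] by simp
  moreover have "E x y ?f = E x y f"
  proof -
    have "E x y ?f = Cmp H (Eo x) (Eo z) (Eo y) (E z y i)
        (Cmp H (Eo x) (Eo y) (Eo z) (E y z g) (E x y f))"
      using E_comp[OF o(1,3,2) h iH] E_comp[OF o f g] eq by simp
    also have "\<dots> = Cmp H (Eo x) (Eo y) (Eo y)
        (Cmp H (Eo y) (Eo z) (Eo y) (E z y i) (E y z g)) (E x y f)"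
      using groupoid_assoc[OF grpd_H E_obj E_obj E_obj E_obj E_hom E_hom E_hom] o f g iH by simp
    also have "\<dots> = E x y f"
      using groupoid_functor_inverse[OF functor_E o(2,3) i] groupoid_idl[OF grpd_H E_obj E_obj E_hom] o f
      by (simp add: inverse_arrows_def)
    finally show ?thesis .
  qed
  ultimately show ?thesis
    using that groupoid_Cmp[OF grpd o(1,3,2) h iH] by blast
qed

section \<open>Cosets modulo the kernel\<close>

lemma arrow_coset_eq_fibre:
  assumes o: "x \<in> Obj G" "y \<in> Obj G" and h: "h \<in> Hom G x y"
  shows "arrow_coset G K x y h = {h' \<in> Hom G x y. E x y h' = E x y h}"
proof (intro subset_antisym subsetI)
  fix h' assume "h' \<in> arrow_coset G K x y h"
  then obtain k where k: "k \<in> Hom G x x" "E x x k = Idn H (Eo x)" "h' = Cmp G x x y h k"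
    by (auto simp: arrow_coset_def Hom_K)
  have "E x y h' = Cmp H (Eo x) (Eo x) (Eo y) (E x y h) (Idn H (Eo x))"
    using E_comp[OF o(1,1,2) k(1) h] k by simp
  then show "h' \<in> {h' \<in> Hom G x y. E x y h' = E x y h}"
    using groupoid_idr[OF grpd_H E_obj E_obj E_hom] groupoid_Cmp[OF grpd o(1,1,2) k(1) h] o h k(3) by simp
next
  fix h' assume h': "h' \<in> {h' \<in> Hom G x y. E x y h' = E x y h}"
  have "E x y h' = E x y (Cmp G x x y h (Idn G x))"
    using h' groupoid_idr[OF grpd o h] by simp
  then obtain k where "k \<in> Hom G x x" "E x x k = E x x (Idn G x)" "Cmp G x x y h k = h'"
    using divide_left[OF o(1,1,2) h _ groupoid_Idn[OF grpd o(1)]] h' by blast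
  then show "h' \<in> arrow_coset G K x y h"
    using E_id[OF o(1)] by (auto simp: arrow_coset_def Hom_K)
qed

text \<open>All sets involved are fibres of \<open>E\<close>. Composites of members lie over
  \<open>E\<close> of the composite by functoriality; conversely \<open>divide_left\<close> writes
  any arrow of that fibre as \<open>g\<close> after a member of the coset of
  \<open>f\<close>.\<close>

lemma arrow_coset_comp:
  assumes o: "x \<in> Obj G" "y \<in> Obj G" "z \<in> Obj G" and f: "f \<in> Hom G x y" and g: "g \<in> Hom G y z"
  shows "Cmp (quotient_groupoid G K) x y z (arrow_coset G K y z g) (arrow_coset G K x y f) =
    arrow_coset G K x z (Cmp G x y z g f)"
proof -
  note gf = groupoid_Cmp[OF grpd o f g]
  have "Cmp G x y z b a \<in> Hom G x z \<and> E x z (Cmp G x y z b a) = E x z (Cmp G x y z g f)"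
    if "b \<in> Hom G y z" "E y z b = E y z g" "a \<in> Hom G x y" "E x y a = E x y f" for a b
    using groupoid_Cmp[OF grpd o] E_comp[OF o] that f g by simp
  moreover have "\<exists>b a. h = Cmp G x y z b a \<and> (b \<in> Hom G y z \<and> E y z b = E y z g) \<and>
      a \<in> Hom G x y \<and> E x y a = E x y f"
    if "h \<in> Hom G x z" "E x z h = E x z (Cmp G x y z g f)" for h
    using divide_left[OF o g that(1) f that(2)] g by metis
  ultimately show ?thesis
    unfolding arrow_coset_eq_fibre[OF o(1,2) f] arrow_coset_eq_fibre[OF o(2,3) g]
      arrow_coset_eq_fibre[OF o(1,3) gf]
    by (auto simp: quotient_groupoid_def)
qed

text \<open>Applying \<open>E\<close> to the relation between \<open>k\<close> and its inverse
  leaves \<open>E x x i\<close> composed with an identity.\<close>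

lemma inverse_in_kernel:
  assumes x: "x \<in> Obj G" and k: "k \<in> Hom K x x" and i: "inverse_arrows G x x k i"
  shows "i \<in> Hom K x x"
proof -
  have ii: "i \<in> Hom G x x" using i by (simp add: inverse_arrows_def)
  have "Cmp H (Eo x) (Eo x) (Eo x) (E x x i) (Idn H (Eo x)) = Idn H (Eo x)"
    using groupoid_functor_inverse[OF functor_E x x i] k by (simp add: inverse_arrows_def Hom_K)
  then show ?thesis
    using groupoid_idr[OF grpd_H E_obj E_obj E_hom] x ii by (simp add: Hom_K)
qed

lemma groupoid_kernel: "groupoid K"
proof -
  have sub: "f \<in> Hom G x y" if "f \<in> Hom K x y" for x y f
    using that by (auto simp: Hom_K split: if_splits)
  have comp: "Cmp G x y z g f \<in> Hom K x z"
    if "x \<in> Obj G" "f \<in> Hom K x y" "g \<in> Hom K y z" for x y z f g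
  proof -
    have e: "y = x" "z = x" using that by (auto simp: Hom_K split: if_splits)
    have f: "f \<in> Hom G x x" "E x x f = Idn H (Eo x)" and g: "g \<in> Hom G x x" "E x x g = Idn H (Eo x)"
      using that unfolding e by (auto simp: Hom_K)
    show ?thesis
      unfolding e using groupoid_Cmp[OF grpd that(1,1,1) f(1) g(1)] E_comp[OF that(1,1,1) f(1) g(1)] f g
        groupoid_idl[OF grpd_H E_obj[OF that(1)] E_obj[OF that(1)] groupoid_Idn[OF grpd_H E_obj[OF that(1)]]]
      by (simp add: Hom_K)
  qed
  have inv: "\<exists>g. inverse_arrows K x y f g" if x: "x \<in> Obj G" and "y \<in> Obj G" and fK: "f \<in> Hom K x y" for x y f
  proof -
    have e: "y = x" using that by (auto simp: Hom_K split: if_splits)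
    have f: "f \<in> Hom K x x" using fK unfolding e .
    obtain i where i: "inverse_arrows G x x f i"
      using groupoid_inverse[OF grpd x x sub[OF f]] .
    then have "inverse_arrows K x x f i"
      using f inverse_in_kernel[OF x f i] by (simp add: inverse_arrows_def)
    then show ?thesis unfolding e by blast
  qed
  have "Idn G x \<in> Hom K x x" if "x \<in> Obj G" for x
    using that groupoid_Idn[OF grpd] E_id by (simp add: Hom_K)
  then show ?thesis
  proof (intro groupoidI, unfold K_simps, goal_cases)
    case (2 x y z f g)
    show ?case using comp[OF 2(2,5,6)] .
  next
    case (3 x y f)
    show ?case using groupoid_idr[OF grpd 3(2,3) sub[OF 3(4)]] .
  next
    case (4 x y f)
    show ?case using groupoid_idl[OF grpd 4(2,3) sub[OF 4(4)]] .
  next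
    case (5 w x y z f g h)
    show ?case using groupoid_assoc[OF grpd 5(2-5) 5(6-8)[THEN sub]] .
  next
    case (6 x y f)
    show ?case using inv[OF 6(2-4)] .
  qed
qed

lemma wide_normal_kernel: "wide_normal_subgroupoid K G"
proof -
  have "Cmp G y x y g (Cmp G y x x k g') \<in> Hom K y y"
    if o: "x \<in> Obj G" "y \<in> Obj G" and k: "k \<in> Hom K x x" and i: "inverse_arrows G x y g g'" for x y k g g'
  proof -
    have h: "k \<in> Hom G x x" "E x x k = Idn H (Eo x)" "g \<in> Hom G x y" "g' \<in> Hom G y x"
      using k i by (auto simp: Hom_K inverse_arrows_def)
    note kg = groupoid_Cmp[OF grpd o(2,1,1) h(4,1)]
    have "E y x (Cmp G y x x k g') = E y x g'"
      using E_comp[OF o(2,1,1) h(4,1)] groupoid_idl[OF grpd_H E_obj E_obj E_hom] h o by simp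
    then have "E y y (Cmp G y x y g (Cmp G y x x k g')) = Idn H (Eo y)"
      using E_comp[OF o(2,1,2) kg h(3)] groupoid_functor_inverse[OF functor_E o i]
      by (simp add: inverse_arrows_def)
    then show ?thesis
      using groupoid_Cmp[OF grpd o(2,1,2) kg h(3)] by (simp add: Hom_K)
  qed
  moreover have "Hom K x y \<subseteq> Hom G x y" for x y
    by (auto simp: Hom_K)
  ultimately show ?thesis
    unfolding wide_normal_subgroupoid_def using grpd groupoid_kernel by simp
qed

section \<open>The quotient groupoid and the faithful factorisation\<close>

abbreviation "GK \<equiv> quotient_groupoid G K"

lemma GK_simps: "Obj GK = Obj G" "Hom GK x y = arrow_coset G K x y ` Hom G x y"
  "Idn GK x = arrow_coset G K x x (Idn G x)"
  by (simp_all add: quotient_groupoid_def)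

text \<open>Passing to cosets is multiplicative and onto on arrows, so each groupoid law is the
  image of the same law in \<open>G\<close>, and an inverse in \<open>G\<close> represents an
  inverse.\<close>

lemma groupoid_quotient: "groupoid GK"
proof -
  have inv: "\<exists>B. inverse_arrows GK x y (arrow_coset G K x y f) B"
    if o: "x \<in> Obj G" "y \<in> Obj G" and f: "f \<in> Hom G x y" for x y f
  proof -
    obtain g where g: "inverse_arrows G x y f g"
      using groupoid_inverse[OF grpd o f] .
    then have gH: "g \<in> Hom G y x" by (simp add: inverse_arrows_def)
    have "inverse_arrows GK x y (arrow_coset G K x y f) (arrow_coset G K y x g)"
      using g f gH arrow_coset_comp[OF o o(1) f gH] arrow_coset_comp[OF o(2,1,2) gH f]
      by (simp add: inverse_arrows_def GK_simps)
    then show ?thesis by blast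
  qed
  show ?thesis
  proof (rule groupoidI; unfold GK_simps; (elim imageE)?; hypsubst?)
    fix x y z f g
    assume o: "x \<in> Obj G" "y \<in> Obj G" "z \<in> Obj G" and fg: "f \<in> Hom G x y" "g \<in> Hom G y z"
    show "Cmp GK x y z (arrow_coset G K y z g) (arrow_coset G K x y f) \<in> arrow_coset G K x z ` Hom G x z"
      unfolding arrow_coset_comp[OF o fg] using groupoid_Cmp[OF grpd o fg] by (rule imageI)
  next
    fix x y f
    assume o: "x \<in> Obj G" "y \<in> Obj G" and f: "f \<in> Hom G x y"
    show "Cmp GK x x y (arrow_coset G K x y f) (arrow_coset G K x x (Idn G x)) = arrow_coset G K x y f"
      unfolding arrow_coset_comp[OF o(1) o groupoid_Idn[OF grpd o(1)] f] groupoid_idr[OF grpd o f] ..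
    show "Cmp GK x y y (arrow_coset G K y y (Idn G y)) (arrow_coset G K x y f) = arrow_coset G K x y f"
      unfolding arrow_coset_comp[OF o o(2) f groupoid_Idn[OF grpd o(2)]] groupoid_idl[OF grpd o f] ..
    show "\<exists>B. inverse_arrows GK x y (arrow_coset G K x y f) B"
      using inv[OF o f] .
  next
    fix x assume "x \<in> Obj G"
    then show "arrow_coset G K x x (Idn G x) \<in> arrow_coset G K x x ` Hom G x x"
      by (intro imageI groupoid_Idn[OF grpd])
  next
    fix w x y z f g h
    assume o: "w \<in> Obj G" "x \<in> Obj G" "y \<in> Obj G" "z \<in> Obj G"
      and f: "f \<in> Hom G w x" and g: "g \<in> Hom G x y" and h: "h \<in> Hom G y z"
    show "Cmp GK w x z (Cmp GK x y z (arrow_coset G K y z h) (arrow_coset G K x y g)) (arrow_coset G K w x f) =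
      Cmp GK w y z (arrow_coset G K y z h) (Cmp GK w x y (arrow_coset G K x y g) (arrow_coset G K w x f))"
      unfolding arrow_coset_comp[OF o(2-4) g h] arrow_coset_comp[OF o(1-3) f g]
        arrow_coset_comp[OF o(1,2,4) f groupoid_Cmp[OF grpd o(2-4) g h]]
        arrow_coset_comp[OF o(1,3,4) groupoid_Cmp[OF grpd o(1-3) f g] h]
        groupoid_assoc[OF grpd o f g h] ..
  qed
qed

lemma functor_arrow_coset: "groupoid_functor G GK (\<lambda>x. x) (arrow_coset G K)"
  unfolding groupoid_functor_def GK_simps
proof (intro conjI ballI grpd groupoid_quotient refl)
  fix x y z f g
  assume "x \<in> Obj G" "y \<in> Obj G" "z \<in> Obj G" "f \<in> Hom G x y" "g \<in> Hom G y z"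
  then show "arrow_coset G K x z (Cmp G x y z g f) =
      Cmp GK x y z (arrow_coset G K y z g) (arrow_coset G K x y f)"
    by (rule arrow_coset_comp[symmetric])
qed (assumption | rule imageI)+

lemma faithful_factorisation:
  "\<exists>E'. groupoid_functor GK H Eo E' \<and> faithful_on GK E' \<and>
    (\<forall>x \<in> Obj G. \<forall>y \<in> Obj G. \<forall>h \<in> Hom G x y. E x y h = E' x y (arrow_coset G K x y h))"
proof -
  \<comment> \<open>The value at a chosen member is independent of the choice, because a coset is a
    fibre of \<open>E\<close>. For the same reason equal values force equal cosets, which is
    faithfulness.\<close>
  define E' where "E' = (\<lambda>x y B. E x y (SOME b. b \<in> B))"
  have E': "E' x y (arrow_coset G K x y h) = E x y h"
    if "x \<in> Obj G" "y \<in> Obj G" "h \<in> Hom G x y" for x y h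
  proof -
    have "(SOME b. b \<in> arrow_coset G K x y h) \<in> arrow_coset G K x y h"
      unfolding some_in_eq arrow_coset_eq_fibre[OF that] using that(3) by blast
    then show ?thesis
      using that by (simp add: E'_def arrow_coset_eq_fibre)
  qed
  have "groupoid_functor GK H Eo E'"
    unfolding groupoid_functor_def GK_simps ball_simps
  proof (intro conjI ballI groupoid_quotient grpd_H E_obj; (elim imageE)?; hypsubst?)
    fix x assume x: "x \<in> Obj G"
    show "E' x x (arrow_coset G K x x (Idn G x)) = Idn H (Eo x)"
      unfolding E'[OF x x groupoid_Idn[OF grpd x]] by (rule E_id[OF x])
  next
    fix x y f assume f: "x \<in> Obj G" "y \<in> Obj G" "f \<in> Hom G x y"
    show "E' x y (arrow_coset G K x y f) \<in> Hom H (Eo x) (Eo y)"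
      unfolding E'[OF f] by (rule E_hom[OF f])
  next
    fix x y z f g
    assume o: "x \<in> Obj G" "y \<in> Obj G" "z \<in> Obj G" and f: "f \<in> Hom G x y" and g: "g \<in> Hom G y z"
    show "E' x z (Cmp GK x y z (arrow_coset G K y z g) (arrow_coset G K x y f)) =
        Cmp H (Eo x) (Eo y) (Eo z) (E' y z (arrow_coset G K y z g)) (E' x y (arrow_coset G K x y f))"
      unfolding arrow_coset_comp[OF o f g] E'[OF o(1,2) f] E'[OF o(2,3) g]
        E'[OF o(1,3) groupoid_Cmp[OF grpd o f g]]
      by (rule E_comp[OF o f g])
  qed
  moreover have "faithful_on GK E'"
    unfolding faithful_on_def GK_simps inj_on_def
    by (auto simp: E') (simp_all add: arrow_coset_eq_fibre)
  ultimately show ?thesis using E' by auto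
qed

end

section \<open>Morphisms of analytic germs\<close>

text \<open>Functions representing the germs in \<open>maps_to_agerm\<close>. Computations are done
  on these, and \<open>maps_to_agerm_eq\<close> translates the results into germs.\<close>

definition pointed_map :: "'a cmanifold \<Rightarrow> 'a \<Rightarrow> agerm \<Rightarrow> ('a \<Rightarrow> cvec) \<Rightarrow> bool"
  where "pointed_map S x A k \<longleftrightarrow> k x = origin \<and>
    eventually (\<lambda>p. k p \<in> Cn (fst A)) (nhdsin (top_of S) x) \<and>
    (\<forall>i < fst A. hol_at S (\<lambda>p. k p i) x) \<and>
    (\<forall>g \<in> snd A. eventually (\<lambda>p. g (k p) = 0) (nhdsin (top_of S) x))"

lemma maps_to_agerm_eq: "maps_to_agerm S x A = {germ (top_of S) x k | k. pointed_map S x A k}"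
  unfolding maps_to_agerm_def pointed_map_def by (cases A) (simp only: prod.case fst_conv snd_conv)

lemma pointed_map_vanish:
  "pointed_map S x A k \<Longrightarrow> g \<in> snd A \<Longrightarrow> eventually (\<lambda>p. g (k p) = 0) (nhdsin (top_of S) x)"
  by (simp add: pointed_map_def)

text \<open>The pullback of germs along k is injective on the local ring of A.\<close>

definition dominant_map :: "'a cmanifold \<Rightarrow> 'a \<Rightarrow> agerm \<Rightarrow> ('a \<Rightarrow> cvec) \<Rightarrow> bool"
  where "dominant_map S x A k \<longleftrightarrow> analytic_germ A \<and> pointed_map S x A k \<and>
    (\<forall>f. hol_near (fst A) f origin \<and> eventually (\<lambda>p. f (k p) = 0) (nhdsin (top_of S) x) \<longrightarrow> f \<in> snd A)"

lemma dominant_mapD: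
  "dominant_map S x A k \<Longrightarrow> hol_near (fst A) f origin \<Longrightarrow>
    eventually (\<lambda>p. f (k p) = 0) (nhdsin (top_of S) x) \<Longrightarrow> f \<in> snd A"
  by (simp add: dominant_map_def)

lemma origin_in_Cn [simp]: "origin \<in> Cn n"
  by (simp add: Cn_def)

lemma amap_rep_iff:
  "amap_rep A B \<phi> \<longleftrightarrow> \<phi> origin = origin \<and>
    eventually (\<lambda>z. \<phi> z \<in> Cn (fst B)) (nhdsin (ctop (fst A)) origin) \<and>
    (\<forall>i < fst B. hol_near (fst A) (\<lambda>z. \<phi> z i) origin) \<and>
    (\<forall>g \<in> snd B. (\<lambda>z. g (\<phi> z)) \<in> snd A)"
  by (cases A; cases B) (simp add: amap_rep_def)

lemma amap_rep_in_Cn: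
  "amap_rep A B \<phi> \<Longrightarrow> eventually (\<lambda>z. \<phi> z \<in> Cn (fst B)) (nhdsin (ctop (fst A)) origin)"
  by (simp add: amap_rep_iff)

lemma amap_rep_pullback:
  "amap_rep A B \<phi> \<Longrightarrow> g \<in> snd B \<Longrightarrow> (\<lambda>z. g (\<phi> z)) \<in> snd A"
  by (simp add: amap_rep_iff)

lemma analytic_germ_iff:
  "analytic_germ A \<longleftrightarrow>
    (\<forall>f \<in> snd A. hol_near (fst A) f origin) \<and>
    (\<forall>f \<in> snd A. germ (ctop (fst A)) origin f \<subseteq> snd A) \<and>
    (\<lambda>z. 0) \<in> snd A \<and> (\<lambda>z. 1) \<notin> snd A \<and>
    (\<forall>f \<in> snd A. \<forall>g \<in> snd A. (\<lambda>z. f z + g z) \<in> snd A) \<and>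
    (\<forall>f \<in> snd A. \<forall>g. hol_near (fst A) g origin \<longrightarrow> (\<lambda>z. g z * f z) \<in> snd A)"
  by (cases A) (simp add: analytic_germ_def)

lemma amap_rep_filterlim:
  assumes "amap_rep A B \<phi>"
  shows "filterlim \<phi> (nhdsin (ctop (fst B)) origin) (nhdsin (ctop (fst A)) origin)"
  using hol_near_imp_filterlim[of origin "fst A" \<phi> "fst B"] assms by (simp add: amap_rep_iff)

lemma amap_rep_id: "amap_rep A A (\<lambda>z. z)"
  by (simp add: amap_rep_iff hol_near_coordinate eventually_nhdsinI[of "ctop (fst A)" "Cn (fst A)"])

lemma amap_rep_compose:
  assumes \<phi>: "amap_rep A B \<phi>" and \<psi>: "amap_rep B C \<psi>"
  shows "amap_rep A C (\<lambda>z. \<psi> (\<phi> z))"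
  unfolding amap_rep_iff
proof (intro conjI allI impI ballI)
  show "\<psi> (\<phi> origin) = origin"
    using assms by (simp add: amap_rep_iff)
  show "eventually (\<lambda>z. \<psi> (\<phi> z) \<in> Cn (fst C)) (nhdsin (ctop (fst A)) origin)"
    using eventually_compose_filterlim[OF amap_rep_in_Cn[OF \<psi>] amap_rep_filterlim[OF \<phi>]] .
  show "hol_near (fst A) (\<lambda>z. \<psi> (\<phi> z) i) origin" if "i < fst C" for i
    by (rule hol_near_compose[of "fst B" "\<lambda>w. \<psi> w i" \<phi>]) (use assms that in \<open>simp_all add: amap_rep_iff\<close>)
  show "(\<lambda>z. g (\<psi> (\<phi> z))) \<in> snd A" if "g \<in> snd C" for g
  proof -
    have "(\<lambda>w. g (\<psi> w)) \<in> snd B" using amap_rep_pullback[OF \<psi> that] .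
    from amap_rep_pullback[OF \<phi> this] show ?thesis .
  qed
qed

lemma pointed_map_filterlim:
  assumes S: "complex_manifold S" and k: "pointed_map S x A k"
  shows "filterlim k (nhdsin (ctop (fst A)) origin) (nhdsin (top_of S) x)"
proof -
  have "((\<lambda>p. k p i) \<longlongrightarrow> origin i) (nhdsin (top_of S) x)" if "i < fst A" for i
    using hol_at_imp_tendsto[OF S, of "\<lambda>p. k p i" x] k that by (simp add: pointed_map_def)
  then show ?thesis
    using k by (simp add: filterlim_nhdsin_ctop_iff pointed_map_def)
qed

lemma pointed_map_amap:
  assumes S: "complex_manifold S" and x: "x \<in> points S"
    and k: "pointed_map S x A k" and \<phi>: "amap_rep A B \<phi>"
  shows "pointed_map S x B (\<lambda>p. \<phi> (k p))"
  unfolding pointed_map_def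
proof (intro conjI allI impI ballI)
  show "\<phi> (k x) = origin"
    using k \<phi> by (simp add: amap_rep_iff pointed_map_def)
  show "eventually (\<lambda>p. \<phi> (k p) \<in> Cn (fst B)) (nhdsin (top_of S) x)"
    using eventually_compose_filterlim[OF amap_rep_in_Cn[OF \<phi>] pointed_map_filterlim[OF S k]] .
  show "hol_at S (\<lambda>p. \<phi> (k p) i) x" if "i < fst B" for i
    by (rule hol_at_compose_hol_near[OF S x, where f = "\<lambda>w. \<phi> w i" and m = "fst A"])
       (use k \<phi> that in \<open>simp_all add: amap_rep_iff pointed_map_def\<close>)
  show "eventually (\<lambda>p. g (\<phi> (k p)) = 0) (nhdsin (top_of S) x)" if "g \<in> snd B" for g
  proof -
    have "(\<lambda>w. g (\<phi> w)) \<in> snd A" using amap_rep_pullback[OF \<phi> that] .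
    from pointed_map_vanish[OF k this] show ?thesis .
  qed
qed

lemma biholomorphic_at_filterlim:
  assumes "biholomorphic_at S x T y h"
  shows "filterlim h (nhdsin (top_of T) y) (nhdsin (top_of S) x)"
proof -
  obtain U where "x \<in> U" "holomorphic_map_on S T U h" and hx: "h x = y"
    using assms by (auto simp: biholomorphic_at_def)
  then show ?thesis using holomorphic_map_filterlim by fastforce
qed

lemma pointed_map_precompose:
  assumes S: "complex_manifold S" and T: "complex_manifold T"
    and h: "biholomorphic_at S x T y h" and k: "pointed_map T y A k"
  shows "pointed_map S x A (\<lambda>p. k (h p))"
proof -
  obtain U where U: "x \<in> U" "holomorphic_map_on S T U h" and hx: "h x = y"
    using h by (auto simp: biholomorphic_at_def)
  have lim: "filterlim h (nhdsin (top_of T) y) (nhdsin (top_of S) x)"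
    using biholomorphic_at_filterlim[OF h] .
  have "hol_at S (\<lambda>p. k (h p) i) x" if "i < fst A" for i
    using hol_at_compose_holomorphic_map[OF S T U(2,1), of "\<lambda>p. k p i"] k that hx
    by (simp add: pointed_map_def)
  moreover have "eventually (\<lambda>p. k (h p) \<in> Cn (fst A)) (nhdsin (top_of S) x)"
    using k by (intro eventually_compose_filterlim[OF _ lim]) (simp add: pointed_map_def)
  moreover have "eventually (\<lambda>p. g (k (h p)) = 0) (nhdsin (top_of S) x)" if "g \<in> snd A" for g
    using eventually_compose_filterlim[OF pointed_map_vanish[OF k that] lim] .
  ultimately show ?thesis
    using k hx by (simp add: pointed_map_def)
qed

lemma amap_class_self:
  "analytic_germ A \<Longrightarrow> amap_rep A B \<phi> \<Longrightarrow> \<phi> \<in> amap_class A B \<phi>"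
  by (simp add: amap_class_def analytic_germ_iff)

text \<open>The differences of components lie in the ideal of \<open>A\<close>, which vanishes along
  \<open>k\<close>. Finitely many components are concerned, the others being 0 because both values
  lie in \<open>Cn\<close>.\<close>

lemma amap_class_agree:
  assumes S: "complex_manifold S" and k: "pointed_map S x A k"
    and \<phi>: "amap_rep A B \<phi>" and \<psi>: "\<psi> \<in> amap_class A B \<phi>"
  shows "eventually (\<lambda>p. \<psi> (k p) = \<phi> (k p)) (nhdsin (top_of S) x)"
proof -
  have \<psi>': "amap_rep A B \<psi>" and I: "\<And>i. i < fst B \<Longrightarrow> (\<lambda>z. \<psi> z i - \<phi> z i) \<in> snd A"
    using \<psi> by (auto simp: amap_class_def)
  have "eventually (\<lambda>p. \<psi> (k p) i - \<phi> (k p) i = 0) (nhdsin (top_of S) x)" if "i < fst B" for i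
    using pointed_map_vanish[OF k I[OF that]] .
  then have "eventually (\<lambda>p. \<forall>i\<in>{..<fst B}. \<psi> (k p) i - \<phi> (k p) i = 0) (nhdsin (top_of S) x)"
    by (simp add: eventually_ball_finite_distrib)
  moreover have "eventually (\<lambda>p. \<psi> (k p) \<in> Cn (fst B)) (nhdsin (top_of S) x)"
      "eventually (\<lambda>p. \<phi> (k p) \<in> Cn (fst B)) (nhdsin (top_of S) x)"
    using eventually_compose_filterlim[OF amap_rep_in_Cn[OF \<phi>] pointed_map_filterlim[OF S k]]
      eventually_compose_filterlim[OF amap_rep_in_Cn[OF \<psi>'] pointed_map_filterlim[OF S k]] by simp_all
  ultimately show ?thesis
  proof eventually_elim
    case (elim p)
    show ?case
    proof
      fix i show "\<psi> (k p) i = \<phi> (k p) i"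
        using elim by (cases "i < fst B") (auto simp: Cn_def)
    qed
  qed
qed

text \<open>Here the outer argument of \<open>germ_comp\<close> is a class modulo an ideal and not a
  germ. Its members agree along \<open>k\<close>, so the composite is nevertheless a single
  germ.\<close>

lemma germ_comp_amap_class:
  assumes S: "complex_manifold S" and k: "pointed_map S x A k"
    and A: "analytic_germ A" and \<phi>: "amap_rep A B \<phi>"
  shows "germ_comp (top_of S) x (amap_class A B \<phi>) (germ (top_of S) x k) =
    germ (top_of S) x (\<lambda>p. \<phi> (k p))"
proof -
  have "eventually (\<lambda>p. l p = \<phi> (k p)) (nhdsin (top_of S) x)"
    if "\<psi> \<in> amap_class A B \<phi>" "eventually (\<lambda>p. k' p = k p) (nhdsin (top_of S) x)"
      "eventually (\<lambda>p. l p = \<psi> (k' p)) (nhdsin (top_of S) x)" for \<psi> k' l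
    using amap_class_agree[OF S k \<phi> that(1)] that(2,3) by eventually_elim simp
  then have "germ_comp (top_of S) x (amap_class A B \<phi>) (germ (top_of S) x k) \<subseteq>
      germ (top_of S) x (\<lambda>p. \<phi> (k p))"
    unfolding germ_comp_def germ_def by blast
  moreover have "germ (top_of S) x (\<lambda>p. \<phi> (k p)) \<subseteq>
      germ_comp (top_of S) x (amap_class A B \<phi>) (germ (top_of S) x k)"
    unfolding germ_comp_def germ_def[of _ _ "\<lambda>p. \<phi> (k p)"]
    by (intro Collect_mono impI bexI[of _ \<phi>] bexI[of _ k] germ_self amap_class_self[OF A \<phi>])
  ultimately show ?thesis by blast
qed

text \<open>Provides the converse of \<open>amap_class_agree\<close>: congruence modulo the ideal of
  \<open>A\<close> becomes equality of functions along \<open>k\<close>.\<close>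

lemma dominant_map_amap_class:
  assumes S: "complex_manifold S" and k: "dominant_map S x A k" and \<phi>: "amap_rep A B \<phi>"
  shows "amap_class A B \<phi> =
    {\<psi>. amap_rep A B \<psi> \<and> eventually (\<lambda>p. \<psi> (k p) = \<phi> (k p)) (nhdsin (top_of S) x)}"
proof -
  have "\<psi> \<in> amap_class A B \<phi>"
    if \<psi>: "amap_rep A B \<psi>" and ev: "eventually (\<lambda>p. \<psi> (k p) = \<phi> (k p)) (nhdsin (top_of S) x)" for \<psi>
  proof -
    have "(\<lambda>z. \<psi> z i - \<phi> z i) \<in> snd A" if i: "i < fst B" for i
    proof -
      have "hol_near (fst A) (\<lambda>z. \<psi> z i - \<phi> z i) origin"
        using \<phi> \<psi> i by (intro hol_near_diff) (auto simp: amap_rep_iff)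
      moreover have "eventually (\<lambda>p. \<psi> (k p) i - \<phi> (k p) i = 0) (nhdsin (top_of S) x)"
        using ev by eventually_elim simp
      ultimately show ?thesis using dominant_mapD[OF k] by simp
    qed
    with \<psi> show ?thesis by (simp add: amap_class_def)
  qed
  moreover have "amap_rep A B \<psi>" if "\<psi> \<in> amap_class A B \<phi>" for \<psi>
    using that by (simp add: amap_class_def)
  moreover have "pointed_map S x A k" using k by (simp add: dominant_map_def)
  note amap_class_agree[OF S this \<phi>]
  ultimately show ?thesis by (intro set_eqI iffI) simp_all
qed

lemma dominant_map_amap_class_eq_iff:
  assumes S: "complex_manifold S" and k: "dominant_map S x A k"
    and \<phi>: "amap_rep A B \<phi>" and \<psi>: "amap_rep A B \<psi>"
  shows "amap_class A B \<psi> = amap_class A B \<phi> \<longleftrightarrow>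
    germ (top_of S) x (\<lambda>p. \<psi> (k p)) = germ (top_of S) x (\<lambda>p. \<phi> (k p))" (is "_ \<longleftrightarrow> ?R")
proof
  assume "amap_class A B \<psi> = amap_class A B \<phi>"
  moreover have "\<psi> \<in> amap_class A B \<psi>"
    using amap_class_self[OF _ \<psi>] k by (simp add: dominant_map_def)
  ultimately show ?R
    by (simp add: germ_eq_iff dominant_map_amap_class[OF S k \<phi>])
next
  assume R: ?R
  then have ev: "eventually (\<lambda>p. \<psi> (k p) = \<phi> (k p)) (nhdsin (top_of S) x)"
    by (simp add: germ_eq_iff)
  have "eventually (\<lambda>p. \<theta> (k p) = \<psi> (k p)) (nhdsin (top_of S) x) \<longleftrightarrow>
      eventually (\<lambda>p. \<theta> (k p) = \<phi> (k p)) (nhdsin (top_of S) x)" for \<theta>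
    by (rule eventually_cong[OF ev]) simp
  then show "amap_class A B \<psi> = amap_class A B \<phi>"
    unfolding dominant_map_amap_class[OF S k \<phi>] dominant_map_amap_class[OF S k \<psi>] by simp
qed

text \<open>
  For a general source A, independence of the representative of the inner map would need
  Hadamard's lemma; a dominant map into A reduces it to an equality of functions.
\<close>

lemma amap_comp_class:
  assumes S: "complex_manifold S" and x: "x \<in> points S" and k: "dominant_map S x A k"
    and B: "analytic_germ B" and \<phi>: "amap_rep A B \<phi>" and \<psi>: "amap_rep B C \<psi>"
  shows "amap_comp A B C (amap_class B C \<psi>) (amap_class A B \<phi>) = amap_class A C (\<lambda>z. \<psi> (\<phi> z))"
proof -
  have pk: "pointed_map S x A k" and A: "analytic_germ A" using k by (auto simp: dominant_map_def)
  have "amap_class A C (\<lambda>z. \<psi>' (\<phi>' z)) = amap_class A C (\<lambda>z. \<psi> (\<phi> z))"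
    if \<psi>': "\<psi>' \<in> amap_class B C \<psi>" and \<phi>': "\<phi>' \<in> amap_class A B \<phi>" for \<psi>' \<phi>'
  proof -
    have r: "amap_rep B C \<psi>'" "amap_rep A B \<phi>'"
      using that by (auto simp: amap_class_def)
    have "eventually (\<lambda>p. \<phi>' (k p) = \<phi> (k p)) (nhdsin (top_of S) x)"
      using amap_class_agree[OF S pk \<phi> \<phi>'] .
    \<comment> \<open>The outer representatives are compared along \<open>\<phi>\<close> after
      \<open>k\<close>, a map into \<open>B\<close> on which the ideal of \<open>B\<close>
      vanishes.\<close>
    moreover have "eventually (\<lambda>p. \<psi>' (\<phi> (k p)) = \<psi> (\<phi> (k p))) (nhdsin (top_of S) x)"
      using amap_class_agree[OF S pointed_map_amap[OF S x pk \<phi>] \<psi> \<psi>'] .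
    ultimately have "eventually (\<lambda>p. \<psi>' (\<phi>' (k p)) = \<psi> (\<phi> (k p))) (nhdsin (top_of S) x)"
      by eventually_elim simp
    then show ?thesis
      using dominant_map_amap_class_eq_iff[OF S k amap_rep_compose[OF \<phi> \<psi>] amap_rep_compose[OF r(2,1)]]
      by (simp add: germ_eq_iff)
  qed
  then have "amap_comp A B C (amap_class B C \<psi>) (amap_class A B \<phi>) =
      (\<Union>\<psi>'\<in>amap_class B C \<psi>. \<Union>\<phi>'\<in>amap_class A B \<phi>. amap_class A C (\<lambda>z. \<psi> (\<phi> z)))"
    unfolding amap_comp_def by (intro SUP_cong refl)
  then show ?thesis
    using amap_class_self[OF A \<phi>] amap_class_self[OF B \<psi>] by (auto simp: UN_constant)
qed

text \<open>A dominant map into each object makes composition of classes computable on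
  representatives. Identity and associativity laws are then those of composition of
  functions.\<close>

lemma groupoid_Iso_groupoid:
  fixes Qs :: "agerm set"
  assumes "\<And>A. A \<in> Qs \<Longrightarrow>
    \<exists>(S :: 'a cmanifold) x k. complex_manifold S \<and> x \<in> points S \<and> dominant_map S x A k"
  shows "groupoid (Iso_groupoid Qs)"
proof -
  have an: "analytic_germ A" if "A \<in> Qs" for A
    using assms[OF that] unfolding dominant_map_def by blast
  have comp: "amap_comp A B C (amap_class B C \<psi>) (amap_class A B \<phi>) = amap_class A C (\<lambda>z. \<psi> (\<phi> z))"
    if A: "A \<in> Qs" and B: "B \<in> Qs" and r: "amap_rep A B \<phi>" "amap_rep B C \<psi>" for A B C \<phi> \<psi>
  proof -
    obtain S :: "'a cmanifold" and x k
      where "complex_manifold S" "x \<in> points S" "dominant_map S x A k"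
      using assms[OF A] by blast
    from amap_comp_class[OF this an[OF B] r] show ?thesis .
  qed
  have rep: "\<exists>\<phi>. amap_rep A B \<phi> \<and> \<Phi> = amap_class A B \<phi>" if "\<Phi> \<in> amaps A B" for A B \<Phi>
    using that unfolding amaps_def by blast
  have amapsI: "amap_class A B \<phi> \<in> amaps A B" if "amap_rep A B \<phi>" for A B \<phi>
    using that unfolding amaps_def by blast
  have idl: "amap_comp A B B (amap_id B) \<Phi> = \<Phi>" if Q: "A \<in> Qs" "B \<in> Qs" and m: "\<Phi> \<in> amaps A B" for A B \<Phi>
  proof -
    obtain \<phi> where \<phi>: "amap_rep A B \<phi>" and e: "\<Phi> = amap_class A B \<phi>"
      using rep[OF m] by blast
    show ?thesis unfolding e amap_id_def comp[OF Q \<phi> amap_rep_id] ..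
  qed
  have idr: "amap_comp A A B \<Phi> (amap_id A) = \<Phi>" if Q: "A \<in> Qs" and m: "\<Phi> \<in> amaps A B" for A B \<Phi>
  proof -
    obtain \<phi> where \<phi>: "amap_rep A B \<phi>" and e: "\<Phi> = amap_class A B \<phi>"
      using rep[OF m] by blast
    show ?thesis unfolding e amap_id_def comp[OF Q Q amap_rep_id \<phi>] ..
  qed
  have closed: "amap_comp A B C \<Psi> \<Phi> \<in> amaps A C"
    if Q: "A \<in> Qs" "B \<in> Qs" and m: "\<Phi> \<in> amaps A B" "\<Psi> \<in> amaps B C" for A B C \<Phi> \<Psi>
  proof -
    obtain \<phi> \<psi> where r: "amap_rep A B \<phi>" "amap_rep B C \<psi>"
      and e: "\<Phi> = amap_class A B \<phi>" "\<Psi> = amap_class B C \<psi>"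
      using rep[OF m(1)] rep[OF m(2)] by blast
    show ?thesis unfolding e comp[OF Q r] by (rule amapsI[OF amap_rep_compose[OF r]])
  qed
  have assoc: "amap_comp A B D (amap_comp B C D X \<Psi>) \<Phi> = amap_comp A C D X (amap_comp A B C \<Psi> \<Phi>)"
    if Q: "A \<in> Qs" "B \<in> Qs" "C \<in> Qs" and m: "\<Phi> \<in> amaps A B" "\<Psi> \<in> amaps B C" "X \<in> amaps C D"
    for A B C D \<Phi> \<Psi> X
  proof -
    obtain \<phi> \<psi> \<theta> where r: "amap_rep A B \<phi>" "amap_rep B C \<psi>" "amap_rep C D \<theta>"
      and e: "\<Phi> = amap_class A B \<phi>" "\<Psi> = amap_class B C \<psi>" "X = amap_class C D \<theta>"
      using rep[OF m(1)] rep[OF m(2)] rep[OF m(3)] by blast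
    show ?thesis
      unfolding e comp[OF Q(2,3) r(2,3)] comp[OF Q(1,2) r(1,2)]
        comp[OF Q(1,2) r(1) amap_rep_compose[OF r(2,3)]]
        comp[OF Q(1,3) amap_rep_compose[OF r(1,2)] r(3)] ..
  qed
  have idm: "amap_id A \<in> amaps A A" for A
    using amapsI[OF amap_rep_id] by (simp add: amap_id_def)
  have iso: "\<exists>\<Psi>. \<Psi> \<in> aisos B A \<and> amap_comp A B A \<Psi> \<Phi> = amap_id A \<and> amap_comp B A B \<Phi> \<Psi> = amap_id B"
    if "\<Phi> \<in> aisos A B" for A B \<Phi>
    using that unfolding aisos_def by blast
  have isom: "\<Phi> \<in> amaps A B" if "\<Phi> \<in> aisos A B" for A B \<Phi>
    using that unfolding aisos_def by blast
  have id_iso: "amap_id A \<in> aisos A A" if "A \<in> Qs" for A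
    using idm idl[OF that that idm] unfolding aisos_def by blast
  have comp_iso: "amap_comp A B C \<Psi> \<Phi> \<in> aisos A C"
    if Q: "A \<in> Qs" "B \<in> Qs" "C \<in> Qs" and f: "\<Phi> \<in> aisos A B" and g: "\<Psi> \<in> aisos B C" for A B C \<Phi> \<Psi>
  proof -
    obtain \<Phi>' where f': "\<Phi>' \<in> amaps B A" "amap_comp A B A \<Phi>' \<Phi> = amap_id A" "amap_comp B A B \<Phi> \<Phi>' = amap_id B"
      using iso[OF f] isom by blast
    obtain \<Psi>' where g': "\<Psi>' \<in> amaps C B" "amap_comp B C B \<Psi>' \<Psi> = amap_id B" "amap_comp C B C \<Psi> \<Psi>' = amap_id C"
      using iso[OF g] isom by blast
    note fm = isom[OF f] and gm = isom[OF g]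
    have "amap_comp A C A (amap_comp C B A \<Phi>' \<Psi>') (amap_comp A B C \<Psi> \<Phi>) =
        amap_comp A B A \<Phi>' (amap_comp A C B \<Psi>' (amap_comp A B C \<Psi> \<Phi>))"
      using assoc[OF Q(1,3,2) closed[OF Q(1,2) fm gm] g'(1) f'(1)] .
    also have "amap_comp A C B \<Psi>' (amap_comp A B C \<Psi> \<Phi>) = \<Phi>"
      using assoc[OF Q fm gm g'(1)] idl[OF Q(1,2) fm] g'(2) by simp
    finally have 1: "amap_comp A C A (amap_comp C B A \<Phi>' \<Psi>') (amap_comp A B C \<Psi> \<Phi>) = amap_id A"
      using f'(2) by simp
    have "amap_comp C A C (amap_comp A B C \<Psi> \<Phi>) (amap_comp C B A \<Phi>' \<Psi>') =
        amap_comp C B C \<Psi> (amap_comp C A B \<Phi> (amap_comp C B A \<Phi>' \<Psi>'))"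
      using assoc[OF Q(3,1,2) closed[OF Q(3,2) g'(1) f'(1)] fm gm] .
    also have "amap_comp C A B \<Phi> (amap_comp C B A \<Phi>' \<Psi>') = \<Psi>'"
      using assoc[OF Q(3,2,1) g'(1) f'(1) fm] idl[OF Q(3,2) g'(1)] f'(3) by simp
    finally have 2: "amap_comp C A C (amap_comp A B C \<Psi> \<Phi>) (amap_comp C B A \<Phi>' \<Psi>') = amap_id C"
      using g'(3) by simp
    show ?thesis
      using closed[OF Q(1,2) fm gm] closed[OF Q(3,2) g'(1) f'(1)] 1 2 unfolding aisos_def by blast
  qed
  let ?I = "Iso_groupoid Qs"
  have I: "Obj ?I = Qs" "Hom ?I = aisos" "Idn ?I = amap_id" "Cmp ?I = amap_comp"
    by (simp_all add: Iso_groupoid_def)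
  show ?thesis
  proof (rule groupoidI; unfold inverse_arrows_def I)
    show "\<exists>\<Psi>. \<Phi> \<in> aisos A B \<and> \<Psi> \<in> aisos B A \<and> amap_comp A B A \<Psi> \<Phi> = amap_id A \<and>
        amap_comp B A B \<Phi> \<Psi> = amap_id B" if "\<Phi> \<in> aisos A B" for A B \<Phi>
      using iso[OF that] that by simp
  qed (rule id_iso comp_iso idl[OF _ _ isom] idr[OF _ isom] assoc[OF _ _ _ isom isom isom] | assumption)+
qed

section \<open>Analytic envelopes\<close>

lemma flow_step_mono: "U \<subseteq> U' \<Longrightarrow> flow_step M F U p r \<Longrightarrow> flow_step M F U' p r"
proof -
  assume U: "U \<subseteq> U'" and "flow_step M F U p r"
  then obtain V X \<gamma> where *: "opn M V" "V \<subseteq> U" "X \<in> F V"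
    "pathin (top_of M) \<gamma>" "\<gamma> ` {0..1} \<subseteq> V" "\<gamma> 0 = p" "\<gamma> 1 = r"
    "\<forall>t \<in> {0..1}. \<forall>f. hol_at M f (\<gamma> t) \<longrightarrow>
            ((\<lambda>s. f (\<gamma> s)) has_vector_derivative X f (\<gamma> t)) (at t within {0..1})"
    unfolding flow_step_def by (elim exE conjE)
  show ?thesis
    unfolding flow_step_def
    by (intro exI[of _ V] exI[of _ X] exI[of _ \<gamma>] conjI * order_trans[OF *(2) U])
qed

text \<open>An orbit can only grow with the open set, so constancy on the leaves of an open set
  passes to the leaves of smaller open sets.\<close>

lemma leaf_through_mono:
  assumes "U \<subseteq> U'"
  shows "leaf_through M F U p \<subseteq> leaf_through M F U' p"
proof -
  have "flow_step M F U \<le> flow_step M F U'"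
    using flow_step_mono[OF assms] by (intro predicate2I)
  from predicate2D[OF rtranclp_mono[OF this]] show ?thesis
    unfolding leaf_through_def by (intro Collect_mono impI)
qed

text \<open>A leaf of a small neighbourhood of x is carried onto a leaf of the image, hence into a
  leaf of \<open>V\<close>, where \<open>f\<close> is constant. This makes the envelope map of the
  target, composed with an arrow, eligible for factorisation.\<close>

lemma leafwise_constant_precompose:
  assumes S: "complex_manifold S" and T: "complex_manifold T"
    and h: "h \<in> leaf_preserving_germs S F x T F' y" and c: "c \<in> leafwise_constant_maps T F' y Y"
  shows "germ_comp (top_of S) x c h \<in> leafwise_constant_maps S F x Y"
proof -
  obtain h0 where h0: "h = germ (top_of S) x h0" and bih: "biholomorphic_at S x T y h0"
    and pres: "preserves_local_leaves S F x T F' h0"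
    using h by (auto simp: leaf_preserving_germs_def)
  obtain f where cY: "c \<in> maps_to_agerm T y Y" and fc: "f \<in> c" and f: "constant_on_local_leaves T F' y f"
    using c by (auto simp: leafwise_constant_maps_def)
  obtain k where k: "c = germ (top_of T) y k" "pointed_map T y Y k"
    using cY by (auto simp: maps_to_agerm_eq)
  note lim = biholomorphic_at_filterlim[OF bih]
  have ck: "germ_comp (top_of S) x c h = germ (top_of S) x (\<lambda>p. k (h0 p))"
    unfolding h0 k(1) by (rule germ_comp_germ[OF lim])
  \<comment> \<open>The representative that is constant on leaves need not be the one exhibiting
    holomorphy; they agree near y.\<close>
  have fk: "eventually (\<lambda>w. f w = k w) (nhdsin (top_of T) y)"
    using fc unfolding k(1) germ_def by simp
  have "(\<lambda>p. f (h0 p)) \<in> germ_comp (top_of S) x c h"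
    unfolding ck germ_def using eventually_compose_filterlim[OF fk lim] by simp
  moreover have "constant_on_local_leaves S F x (\<lambda>p. f (h0 p))"
  proof -
    obtain V where V: "opn T V" "y \<in> V" and Vc: "\<And>A p r. A \<in> leaves T F' V \<Longrightarrow> p \<in> A \<Longrightarrow> r \<in> A \<Longrightarrow> f p = f r"
      using f unfolding constant_on_local_leaves_def by blast
    obtain U0 where U0: "opn S U0" "x \<in> U0"
      and bij: "\<And>U. opn S U \<Longrightarrow> x \<in> U \<Longrightarrow> U \<subseteq> U0 \<Longrightarrow>
        bij_betw (image h0) (leaves S F U) (leaves T F' (h0 ` U))"
      using pres unfolding preserves_local_leaves_def by blast
    have "eventually (\<lambda>p. h0 p \<in> V) (nhdsin (top_of S) x)"
      using eventually_compose_filterlim[OF _ lim, of "\<lambda>w. w \<in> V"] eventually_nhdsinI[OF V] by simp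
    then obtain W where W: "opn S W" "x \<in> W" "\<And>p. p \<in> W \<Longrightarrow> h0 p \<in> V"
      using U0 openin_subset[OF U0(1)] by (auto simp: eventually_nhdsin)
    \<comment> \<open>Small enough for \<open>h0\<close> to carry leaves to leaves and for its image
      to lie in \<open>V\<close>.\<close>
    let ?U = "U0 \<inter> W"
    have U: "opn S ?U" "x \<in> ?U" using U0 W by auto
    have "f (h0 p) = f (h0 r)" if A: "A \<in> leaves S F ?U" "p \<in> A" "r \<in> A" for A p r
    proof -
      have "h0 ` A \<in> leaves T F' (h0 ` ?U)"
        using bij_betwE[OF bij[OF U]] A(1) by simp
      then obtain w where w: "w \<in> h0 ` ?U" "h0 ` A = leaf_through T F' (h0 ` ?U) w"
        by (auto simp: leaves_def)
      have sub: "h0 ` ?U \<subseteq> V" using W(3) by auto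
      have "leaf_through T F' V w \<in> leaves T F' V" using w(1) sub by (auto simp: leaves_def)
      moreover have "h0 ` A \<subseteq> leaf_through T F' V w"
        using leaf_through_mono[OF sub] w(2) by simp
      ultimately show ?thesis using Vc[of _ "h0 p" "h0 r"] A(2,3) by blast
    qed
    then show ?thesis
      unfolding constant_on_local_leaves_def by (intro exI[of _ ?U] conjI U ballI)
  qed
  moreover have "germ_comp (top_of S) x c h \<in> maps_to_agerm S x Y"
    unfolding ck maps_to_agerm_eq
    by (intro CollectI exI[of _ "\<lambda>p. k (h0 p)"] conjI refl pointed_map_precompose[OF S T bih k(2)])
  ultimately show ?thesis
    unfolding leafwise_constant_maps_def by (intro CollectI conjI bexI[of _ "\<lambda>p. f (h0 p)"])
qed

lemma amap_class_in_amaps: "amap_rep A B \<phi> \<Longrightarrow> amap_class A B \<phi> \<in> amaps A B"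
  unfolding amaps_def by blast

lemma analytic_envelope_factor:
  "analytic_envelope S F x Q q \<Longrightarrow> analytic_germ Y \<Longrightarrow> c \<in> leafwise_constant_maps S F x Y \<Longrightarrow>
    \<exists>!\<Phi>. \<Phi> \<in> amaps Q Y \<and> germ_comp (top_of S) x \<Phi> q = c"
  unfolding analytic_envelope_def by (elim conjE) (drule spec, drule (1) mp, erule (1) bspec)

text \<open>This is the smooth germ (C^n, 0): the ideal is zero, represented by the functions that
  vanish near the origin.\<close>

lemma analytic_germ_vanishing:
  "analytic_germ (n, {f. eventually (\<lambda>z. f z = 0) (nhdsin (ctop n) origin)})"
proof -
  let ?N = "nhdsin (ctop n) origin"
  have "hol_near n f origin" if "eventually (\<lambda>z. f z = 0) ?N" for f
    using hol_near_cong[OF hol_near_const[OF origin_in_Cn] that] .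
  moreover have "eventually (\<lambda>z. g z = 0) ?N"
    if "eventually (\<lambda>z. f z = 0) ?N" "eventually (\<lambda>z. g z = f z) ?N" for f g :: "cvec \<Rightarrow> complex"
    using that by eventually_elim simp
  moreover have "eventually (\<lambda>z. f z + g z = 0) ?N"
    if "eventually (\<lambda>z. f z = 0) ?N" "eventually (\<lambda>z. g z = 0) ?N" for f g :: "cvec \<Rightarrow> complex"
    using that by eventually_elim simp
  moreover have "eventually (\<lambda>z. g z = 0 \<or> f z = 0) ?N"
    if "eventually (\<lambda>z. f z = 0) ?N" for f g :: "cvec \<Rightarrow> complex"
    using that by eventually_elim simp
  moreover have "\<not> eventually (\<lambda>z. False) ?N"
    using eventually_nhdsin_self[of "\<lambda>z. False" "ctop n" origin] by auto
  ultimately show ?thesis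
    by (simp add: analytic_germ_iff germ_def subset_iff)
qed

text \<open>
  Uniqueness of the factorisation, applied to maps into the complex line: a function on Q that
  pulls back to 0 factorises the zero map, as does the function 0.
\<close>

lemma analytic_envelope_dominant:
  assumes S: "complex_manifold S" and x: "x \<in> points S" and env: "analytic_envelope S F x Q q"
  obtains k where "q = germ (top_of S) x k" "dominant_map S x Q k"
proof -
  have Q: "analytic_germ Q" using env by (simp add: analytic_envelope_def)
  have "q \<in> maps_to_agerm S x Q"
    using env by (simp add: analytic_envelope_def leafwise_constant_maps_def)
  then obtain k where qk: "q = germ (top_of S) x k" and k: "pointed_map S x Q k"
    by (auto simp: maps_to_agerm_eq)
  let ?n = "fst Q"
  have zero: "f \<in> snd Q" if "eventually (\<lambda>z. f z = 0) (nhdsin (ctop ?n) origin)" for f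
  proof -
    have "f \<in> germ (ctop ?n) origin (\<lambda>z. 0)" using that by (simp add: germ_def)
    then show ?thesis using Q unfolding analytic_germ_iff by blast
  qed
  \<comment> \<open>The germ of the complex line at 0.\<close>
  define Y :: agerm where "Y = (1, {f. eventually (\<lambda>z. f z = 0) (nhdsin (ctop 1) origin)})"
  have Y: "analytic_germ Y" unfolding Y_def by (rule analytic_germ_vanishing)
  \<comment> \<open>Identifies a number with a point of \<open>Cn 1\<close>, so that a function
    becomes a map into \<open>Y\<close>.\<close>
  define \<iota> where "\<iota> = (\<lambda>(c::complex) i. if i = (0::nat) then c else 0)"
  have \<iota>0: "\<iota> 0 = origin" by (auto simp: \<iota>_def)
  have \<iota>C: "\<iota> c \<in> Cn 1" for c by (auto simp: \<iota>_def Cn_def)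
  have rep: "amap_rep Q Y (\<lambda>z. \<iota> (f z))" if f: "hol_near ?n f origin" "f origin = 0" for f
  proof -
    have hol: "hol_near ?n (\<lambda>z. \<iota> (f z) i) origin" if "i < 1" for i
      using f that by (simp add: \<iota>_def)
    have "filterlim (\<lambda>z. \<iota> (f z)) (nhdsin (ctop 1) (\<iota> (f origin))) (nhdsin (ctop ?n) origin)"
      by (rule hol_near_imp_filterlim[where \<phi> = "\<lambda>z. \<iota> (f z)"]) (simp_all add: hol \<iota>C del: One_nat_def)
    then have lim: "filterlim (\<lambda>z. \<iota> (f z)) (nhdsin (ctop 1) origin) (nhdsin (ctop ?n) origin)"
      by (simp add: f(2) \<iota>0)
    \<comment> \<open>Compatibility of ideals: by continuity the pullback of a function vanishing
      near 0 vanishes near the origin, hence represents the zero germ, which lies in every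
      ideal.\<close>
    have "(\<lambda>z. g (\<iota> (f z))) \<in> snd Q" if "eventually (\<lambda>z. g z = 0) (nhdsin (ctop 1) origin)" for g
      using zero[OF eventually_compose_filterlim[OF that lim]] .
    then show ?thesis
      unfolding amap_rep_iff Y_def using hol \<iota>C f(2) \<iota>0 by (simp del: One_nat_def)
  qed
  have "f \<in> snd Q" if f: "hol_near ?n f origin" and ev: "eventually (\<lambda>p. f (k p) = 0) (nhdsin (top_of S) x)" for f
  proof -
    \<comment> \<open>Morphisms of germs preserve base points; the vanishing is evaluated at x
      itself, which \<open>k\<close> sends to the origin.\<close>
    have "f origin = 0"
      using eventually_nhdsin_self[OF ev x] k by (simp add: pointed_map_def)
    note r0 = rep[OF f this]
    have r1: "amap_rep Q Y (\<lambda>z. \<iota> 0)" by (rule rep) (simp_all add: hol_near_const)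
    have eq: "germ (top_of S) x (\<lambda>p. \<iota> (f (k p))) = germ (top_of S) x (\<lambda>p. \<iota> 0)"
      unfolding germ_eq_iff using ev by eventually_elim simp
    have "constant_on_local_leaves S F x (\<lambda>p. \<iota> 0)"
      unfolding constant_on_local_leaves_def using x by blast
    then have "germ (top_of S) x (\<lambda>p. \<iota> 0) \<in> leafwise_constant_maps S F x Y"
      unfolding leafwise_constant_maps_def maps_to_agerm_eq
      by (intro CollectI conjI bexI[of _ "\<lambda>p. \<iota> 0"] exI[of _ "\<lambda>p. \<iota> 0"] refl germ_self
          pointed_map_amap[OF S x k r1])
    then have "\<exists>!\<Phi>. \<Phi> \<in> amaps Q Y \<and> germ_comp (top_of S) x \<Phi> q = germ (top_of S) x (\<lambda>p. \<iota> 0)"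
      by (rule analytic_envelope_factor[OF env Y])
    moreover have "amap_class Q Y (\<lambda>z. \<iota> (f z)) \<in> amaps Q Y" "amap_class Q Y (\<lambda>z. \<iota> 0) \<in> amaps Q Y"
      by (rule amap_class_in_amaps[OF r0], rule amap_class_in_amaps[OF r1])
    moreover have "germ_comp (top_of S) x (amap_class Q Y (\<lambda>z. \<iota> (f z))) q = germ (top_of S) x (\<lambda>p. \<iota> 0)"
      "germ_comp (top_of S) x (amap_class Q Y (\<lambda>z. \<iota> 0)) q = germ (top_of S) x (\<lambda>p. \<iota> 0)"
      unfolding qk germ_comp_amap_class[OF S k Q r0] germ_comp_amap_class[OF S k Q r1] eq by (rule refl)+
    ultimately have "amap_class Q Y (\<lambda>z. \<iota> (f z)) = amap_class Q Y (\<lambda>z. \<iota> 0)"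
      by (elim ex1E) metis
    \<comment> \<open>Membership in the class of the zero map says that the first component, which
      is \<open>f\<close>, lies in the ideal.\<close>
    then have "(\<lambda>z. \<iota> (f z)) \<in> amap_class Q Y (\<lambda>z. \<iota> 0)"
      using amap_class_self[OF Q r0] by simp
    then show ?thesis by (simp add: amap_class_def Y_def \<iota>_def)
  qed
  with Q k have "dominant_map S x Q k" by (simp add: dominant_map_def)
  with qk show ?thesis using that by blast
qed

section \<open>The functor induced on the envelopes\<close>

locale enveloped_transversals =
  fixes L :: "'a set" and S :: "'a \<Rightarrow> 'a cmanifold" and FS :: "'a \<Rightarrow> 'a foliation"
    and Q :: "'a \<Rightarrow> agerm" and q :: "'a \<Rightarrow> ('a \<Rightarrow> cvec) set"
    and H :: "'a \<Rightarrow> 'a \<Rightarrow> ('a \<Rightarrow> 'a) set set" and G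
  defines "G \<equiv> germ_groupoid L S H"
  assumes manifold: "x \<in> L \<Longrightarrow> complex_manifold (S x)"
    and base: "x \<in> L \<Longrightarrow> x \<in> points (S x)"
    and envelope: "x \<in> L \<Longrightarrow> analytic_envelope (S x) (FS x) x (Q x) (q x)"
    and groupoid_G: "groupoid G"
    and arrows: "x \<in> L \<Longrightarrow> y \<in> L \<Longrightarrow> H x y \<subseteq> leaf_preserving_germs (S x) (FS x) x (S y) (FS y) y"
begin

lemma G_simps: "Obj G = L" "Hom G = H" "Idn G x = germ (top_of (S x)) x (\<lambda>p. p)"
  "Cmp G x y z = germ_comp (top_of (S x)) x"
  by (simp_all add: G_def germ_groupoid_def)

lemma q_rep:
  assumes "x \<in> L"
  obtains k where "q x = germ (top_of (S x)) x k" "dominant_map (S x) x (Q x) k"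
  using analytic_envelope_dominant[OF manifold base envelope] assms by blast

lemma arrow_rep:
  assumes "x \<in> L" "y \<in> L" "h \<in> H x y"
  obtains h0 where "h = germ (top_of (S x)) x h0"
    "filterlim h0 (nhdsin (top_of (S y)) y) (nhdsin (top_of (S x)) x)"
proof -
  have "h \<in> leaf_preserving_germs (S x) (FS x) x (S y) (FS y) y"
    using arrows assms by blast
  then obtain h0 where "h = germ (top_of (S x)) x h0" "biholomorphic_at (S x) x (S y) y h0"
    by (auto simp: leaf_preserving_germs_def)
  from that[OF this(1) biholomorphic_at_filterlim[OF this(2)]] show ?thesis .
qed

definition induced :: "'a \<Rightarrow> 'a \<Rightarrow> ('a \<Rightarrow> 'a) set \<Rightarrow> (cvec \<Rightarrow> cvec) set"
  where "induced x y h = (THE \<Phi>. \<Phi> \<in> amaps (Q x) (Q y) \<and>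
    germ_comp (top_of (S x)) x \<Phi> (q x) = germ_comp (top_of (S x)) x (q y) h)"

text \<open>The factorisation property at x, applied to \<open>q y\<close> after \<open>h\<close>.
  The equivalence contains existence, uniqueness and the value of the definite description; all
  later properties of \<open>induced\<close> are derived from it.\<close>

lemma induced_iff:
  assumes x: "x \<in> L" and y: "y \<in> L" and h: "h \<in> H x y"
  shows "\<Phi> \<in> amaps (Q x) (Q y) \<and>
    germ_comp (top_of (S x)) x \<Phi> (q x) = germ_comp (top_of (S x)) x (q y) h \<longleftrightarrow> \<Phi> = induced x y h"
proof -
  have hl: "h \<in> leaf_preserving_germs (S x) (FS x) x (S y) (FS y) y"
    using arrows x y h by blast
  have "q y \<in> leafwise_constant_maps (S y) (FS y) y (Q y)" and Qy: "analytic_germ (Q y)"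
    using envelope[OF y] by (auto simp: analytic_envelope_def)
  from leafwise_constant_precompose[OF manifold[OF x] manifold[OF y] hl this(1)]
  have "germ_comp (top_of (S x)) x (q y) h \<in> leafwise_constant_maps (S x) (FS x) x (Q y)" .
  then have ex1: "\<exists>!\<Phi>. \<Phi> \<in> amaps (Q x) (Q y) \<and>
      germ_comp (top_of (S x)) x \<Phi> (q x) = germ_comp (top_of (S x)) x (q y) h"
    by (rule analytic_envelope_factor[OF envelope[OF x] Qy])
  show ?thesis
    unfolding induced_def
    by (rule iffI) (erule the1_equality[OF ex1, symmetric], hypsubst, rule theI'[OF ex1])
qed

lemmas induced_eqI = induced_iff[THEN iffD1, symmetric, OF _ _ _ conjI]

lemma induced_amap: "x \<in> L \<Longrightarrow> y \<in> L \<Longrightarrow> h \<in> H x y \<Longrightarrow> induced x y h \<in> amaps (Q x) (Q y)"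
  and induced_comp: "x \<in> L \<Longrightarrow> y \<in> L \<Longrightarrow> h \<in> H x y \<Longrightarrow>
    germ_comp (top_of (S x)) x (induced x y h) (q x) = germ_comp (top_of (S x)) x (q y) h"
  by (rule induced_iff[THEN iffD2, OF _ _ _ refl, THEN conjunct1],
      assumption+, rule induced_iff[THEN iffD2, OF _ _ _ refl, THEN conjunct2], assumption+)

lemma amap_id_comp:
  assumes x: "x \<in> L"
  shows "amap_id (Q x) \<in> amaps (Q x) (Q x)" "germ_comp (top_of (S x)) x (amap_id (Q x)) (q x) = q x"
proof -
  obtain k where k: "q x = germ (top_of (S x)) x k" "dominant_map (S x) x (Q x) k"
    using q_rep[OF x] .
  then have "pointed_map (S x) x (Q x) k" "analytic_germ (Q x)" by (auto simp: dominant_map_def)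
  from germ_comp_amap_class[OF manifold[OF x] this amap_rep_id]
  show "germ_comp (top_of (S x)) x (amap_id (Q x)) (q x) = q x"
    by (simp add: amap_id_def k(1))
  show "amap_id (Q x) \<in> amaps (Q x) (Q x)"
    unfolding amap_id_def by (rule amap_class_in_amaps[OF amap_rep_id])
qed

text \<open>The identity of \<open>Q x\<close> factorises \<open>q x\<close> itself, so by
  uniqueness it is induced by exactly those arrows that fix \<open>q x\<close>. Both the identity
  law and the description of the kernel rest on this.\<close>

lemma induced_eq_id_iff:
  assumes x: "x \<in> L" and h: "h \<in> H x x"
  shows "induced x x h = amap_id (Q x) \<longleftrightarrow> germ_comp (top_of (S x)) x (q x) h = q x"
proof -
  have "induced x x h = amap_id (Q x) \<longleftrightarrow> amap_id (Q x) = induced x x h"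
    by (rule eq_commute)
  also have "\<dots> \<longleftrightarrow> q x = germ_comp (top_of (S x)) x (q x) h"
    unfolding induced_iff[OF x x h, symmetric] amap_id_comp(2)[OF x]
    using amap_id_comp(1)[OF x] by (simp only: simp_thms)
  also have "\<dots> \<longleftrightarrow> germ_comp (top_of (S x)) x (q x) h = q x"
    by (rule eq_commute)
  finally show ?thesis .
qed

lemma induced_id:
  assumes x: "x \<in> L"
  shows "induced x x (germ (top_of (S x)) x (\<lambda>p. p)) = amap_id (Q x)"
proof -
  obtain k where k: "q x = germ (top_of (S x)) x k" using q_rep[OF x] by blast
  have "germ (top_of (S x)) x (\<lambda>p. p) \<in> H x x"
    using groupoid_Idn[OF groupoid_G, of x] x by (simp add: G_simps)
  moreover have "germ_comp (top_of (S x)) x (q x) (germ (top_of (S x)) x (\<lambda>p. p)) = q x"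
    unfolding k by (rule germ_comp_germ) (rule filterlim_ident)
  ultimately show ?thesis using induced_eq_id_iff[OF x] by blast
qed

text \<open>Two commutative squares are pasted: near x, \<open>\<psi>\<close> after
  \<open>\<phi>\<close> after \<open>k\<close> is \<open>\<psi>\<close> after \<open>l\<close> after
  \<open>h0\<close>, which is \<open>m\<close> after \<open>g0\<close> after \<open>h0\<close>.
  Uniqueness identifies the outer factorisation.\<close>

lemma induced_compose:
  assumes x: "x \<in> L" and y: "y \<in> L" and z: "z \<in> L" and h: "h \<in> H x y" and g: "g \<in> H y z"
  shows "induced x z (germ_comp (top_of (S x)) x g h) =
    amap_comp (Q x) (Q y) (Q z) (induced y z g) (induced x y h)"
proof -
  obtain k where k: "q x = germ (top_of (S x)) x k" "dominant_map (S x) x (Q x) k"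
    using q_rep[OF x] .
  obtain l where l: "q y = germ (top_of (S y)) y l" "dominant_map (S y) y (Q y) l"
    using q_rep[OF y] .
  obtain m where m: "q z = germ (top_of (S z)) z m"
    using q_rep[OF z] by blast
  obtain h0 where h0: "h = germ (top_of (S x)) x h0"
    and hlim: "filterlim h0 (nhdsin (top_of (S y)) y) (nhdsin (top_of (S x)) x)"
    using arrow_rep[OF x y h] .
  obtain g0 where g0: "g = germ (top_of (S y)) y g0"
    and glim: "filterlim g0 (nhdsin (top_of (S z)) z) (nhdsin (top_of (S y)) y)"
    using arrow_rep[OF y z g] .
  obtain \<phi> where \<phi>: "amap_rep (Q x) (Q y) \<phi>" "induced x y h = amap_class (Q x) (Q y) \<phi>"
    using induced_amap[OF x y h] unfolding amaps_def by blast
  obtain \<psi> where \<psi>: "amap_rep (Q y) (Q z) \<psi>" "induced y z g = amap_class (Q y) (Q z) \<psi>"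
    using induced_amap[OF y z g] unfolding amaps_def by blast
  have pk: "pointed_map (S x) x (Q x) k" "analytic_germ (Q x)"
    and pl: "pointed_map (S y) y (Q y) l" "analytic_germ (Q y)"
    using k l by (auto simp: dominant_map_def)
  have "eventually (\<lambda>p. \<phi> (k p) = l (h0 p)) (nhdsin (top_of (S x)) x)"
    using induced_comp[OF x y h, unfolded \<phi>(2)]
    unfolding k(1) l(1) h0 germ_comp_amap_class[OF manifold[OF x] pk \<phi>(1)] germ_comp_germ[OF hlim]
    by (simp add: germ_eq_iff)
  moreover have "eventually (\<lambda>w. \<psi> (l w) = m (g0 w)) (nhdsin (top_of (S y)) y)"
    using induced_comp[OF y z g, unfolded \<psi>(2)]
    unfolding l(1) m g0 germ_comp_amap_class[OF manifold[OF y] pl \<psi>(1)] germ_comp_germ[OF glim]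
    by (simp add: germ_eq_iff)
  note eventually_compose_filterlim[OF this hlim]
  ultimately have "eventually (\<lambda>p. \<psi> (\<phi> (k p)) = m (g0 (h0 p))) (nhdsin (top_of (S x)) x)"
    by eventually_elim simp
  then have eq: "germ (top_of (S x)) x (\<lambda>p. \<psi> (\<phi> (k p))) = germ (top_of (S x)) x (\<lambda>p. m (g0 (h0 p)))"
    by (simp add: germ_eq_iff)
  have gh: "germ_comp (top_of (S x)) x g h = germ (top_of (S x)) x (\<lambda>p. g0 (h0 p))"
    unfolding g0 h0 by (rule germ_comp_germ[OF hlim])
  note r = amap_rep_compose[OF \<phi>(1) \<psi>(1)]
  show ?thesis
    unfolding \<phi>(2) \<psi>(2) amap_comp_class[OF manifold[OF x] base[OF x] k(2) pl(2) \<phi>(1) \<psi>(1)]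
  proof (rule induced_eqI[OF x z])
    show "germ_comp (top_of (S x)) x g h \<in> H x z"
      using groupoid_Cmp[OF groupoid_G, of x y z h g] assms by (simp add: G_simps)
    show "amap_class (Q x) (Q z) (\<lambda>z. \<psi> (\<phi> z)) \<in> amaps (Q x) (Q z)"
      by (rule amap_class_in_amaps[OF r])
    show "germ_comp (top_of (S x)) x (amap_class (Q x) (Q z) (\<lambda>z. \<psi> (\<phi> z))) (q x) =
        germ_comp (top_of (S x)) x (q z) (germ_comp (top_of (S x)) x g h)"
      unfolding k(1) m gh germ_comp_amap_class[OF manifold[OF x] pk r]
        germ_comp_germ[OF filterlim_compose[OF glim hlim]] by (rule eq)
  qed
qed

text \<open>An inverse arrow induces a two-sided inverse by \<open>induced_compose\<close> and
  \<open>induced_id\<close>, so the values are isomorphisms. Objects of the target are the germs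
  \<open>Q x\<close> themselves; any point with the given envelope supplies the dominant
  map.\<close>

lemma functor_induced: "groupoid_functor G (Iso_groupoid (Q ` L)) Q induced"
proof -
  have iso: "induced x y h \<in> aisos (Q x) (Q y)" if x: "x \<in> L" and y: "y \<in> L" and h: "h \<in> H x y" for x y h
  proof -
    obtain g where "inverse_arrows G x y h g"
      using groupoid_inverse[OF groupoid_G, of x y h] x y h by (auto simp: G_simps)
    then have g: "g \<in> H y x"
      and gh: "germ_comp (top_of (S x)) x g h = germ (top_of (S x)) x (\<lambda>p. p)"
      and hg: "germ_comp (top_of (S y)) y h g = germ (top_of (S y)) y (\<lambda>p. p)"
      by (auto simp: inverse_arrows_def G_simps)
    have "amap_comp (Q x) (Q y) (Q x) (induced y x g) (induced x y h) = amap_id (Q x)"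
      using induced_compose[OF x y x h g] induced_id[OF x] by (simp add: gh)
    moreover have "amap_comp (Q y) (Q x) (Q y) (induced x y h) (induced y x g) = amap_id (Q y)"
      using induced_compose[OF y x y g h] induced_id[OF y] by (simp add: hg)
    ultimately show ?thesis
      using induced_amap[OF x y h] induced_amap[OF y x g] unfolding aisos_def by blast
  qed
  have "groupoid (Iso_groupoid (Q ` L))"
  proof (rule groupoid_Iso_groupoid)
    fix A assume "A \<in> Q ` L"
    then obtain x where x: "x \<in> L" and A: "A = Q x" by blast
    obtain k where "dominant_map (S x) x (Q x) k" using q_rep[OF x] by blast
    then show "\<exists>(S :: 'a cmanifold) x k. complex_manifold S \<and> x \<in> points S \<and> dominant_map S x A k"
      using manifold[OF x] base[OF x] A by blast
  qed
  then show ?thesis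
    unfolding groupoid_functor_def using groupoid_G
    by (simp add: G_simps Iso_groupoid_def iso induced_id induced_compose)
qed

lemma induced_trivial_iff:
  assumes x: "x \<in> L" and h: "h \<in> H x x"
  shows "induced x x h = amap_id (Q x) \<longleftrightarrow>
    (\<forall>f \<in> first_integrals (S x) (FS x) x. germ_comp (top_of (S x)) x f h = f)"
proof -
  let ?T = "top_of (S x)"
  obtain k where k: "q x = germ ?T x k" "dominant_map (S x) x (Q x) k"
    using q_rep[OF x] .
  have pk: "pointed_map (S x) x (Q x) k" using k by (simp add: dominant_map_def)
  obtain h0 where h0: "h = germ ?T x h0" and lim: "filterlim h0 (nhdsin ?T x) (nhdsin ?T x)"
    using arrow_rep[OF x x h] .
  \<comment> \<open>The ring identity of the envelope: first integrals are the pullbacks of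
    holomorphic germs along \<open>k\<close>.\<close>
  have FI: "first_integrals (S x) (FS x) x =
      {germ ?T x (\<lambda>p. f (k' p)) | f k'. hol_near (fst (Q x)) f origin \<and> k' \<in> germ ?T x k}"
    using envelope[OF x] k(1) by (simp add: analytic_envelope_def pullback_ring_def)
  have "germ_comp ?T x (q x) h = q x \<longleftrightarrow> eventually (\<lambda>p. k (h0 p) = k p) (nhdsin ?T x)"
    unfolding k(1) h0 germ_comp_germ[OF lim] germ_eq_iff ..
  also have "\<dots> \<longleftrightarrow> (\<forall>f \<in> first_integrals (S x) (FS x) x. germ_comp ?T x f h = f)"
  proof
    assume ev: "eventually (\<lambda>p. k (h0 p) = k p) (nhdsin ?T x)"
    have "germ_comp ?T x (germ ?T x (\<lambda>p. f (k' p))) h = germ ?T x (\<lambda>p. f (k' p))"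
      if "k' \<in> germ ?T x k" for f :: "cvec \<Rightarrow> complex" and k'
    proof -
      have k': "eventually (\<lambda>p. k' p = k p) (nhdsin ?T x)" using that by (simp add: germ_def)
      from ev k' eventually_compose_filterlim[OF k' lim]
      have "eventually (\<lambda>p. f (k' (h0 p)) = f (k' p)) (nhdsin ?T x)"
        by eventually_elim simp
      then show ?thesis
        unfolding h0 germ_comp_germ[OF lim] germ_eq_iff .
    qed
    then show "\<forall>f \<in> first_integrals (S x) (FS x) x. germ_comp ?T x f h = f"
      unfolding FI by blast
  next
    assume fix_all: "\<forall>f \<in> first_integrals (S x) (FS x) x. germ_comp ?T x f h = f"
    have "eventually (\<lambda>p. k (h0 p) i = k p i) (nhdsin ?T x)" if "i < fst (Q x)" for i
    proof -
      \<comment> \<open>The pullback of the i-th coordinate function. Finitely many coordinates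
        determine \<open>k\<close>, since the remaining ones vanish on \<open>Cn\<close>.\<close>
      have "germ ?T x (\<lambda>p. k p i) \<in> first_integrals (S x) (FS x) x"
        unfolding FI
        by (intro CollectI exI[of _ "\<lambda>z. z i"] exI[of _ k] conjI refl germ_self
            hol_near_coordinate[OF origin_in_Cn that])
      with fix_all have "germ_comp ?T x (germ ?T x (\<lambda>p. k p i)) h = germ ?T x (\<lambda>p. k p i)" by blast
      then show ?thesis unfolding h0 germ_comp_germ[OF lim] germ_eq_iff .
    qed
    then have "eventually (\<lambda>p. \<forall>i\<in>{..<fst (Q x)}. k (h0 p) i = k p i) (nhdsin ?T x)"
      by (simp add: eventually_ball_finite_distrib)
    moreover have kC: "eventually (\<lambda>p. k p \<in> Cn (fst (Q x))) (nhdsin ?T x)"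
      using pk by (simp add: pointed_map_def)
    moreover note eventually_compose_filterlim[OF kC lim]
    ultimately show "eventually (\<lambda>p. k (h0 p) = k p) (nhdsin ?T x)"
    proof eventually_elim
      case (elim p)
      show ?case
      proof
        fix i show "k (h0 p) i = k p i"
          using elim by (cases "i < fst (Q x)") (auto simp: Cn_def)
      qed
    qed
  qed
  finally show ?thesis using induced_eq_id_iff[OF assms] by simp
qed

end

theorem proposition7p2:
  fixes M :: "'a cmanifold"
    and F :: "'a foliation"
    and L :: "'a set"
    and S :: "'a \<Rightarrow> 'a cmanifold"
    and Q :: "'a \<Rightarrow> agerm"
    and q :: "'a \<Rightarrow> ('a \<Rightarrow> cvec) set"
    and H :: "'a \<Rightarrow> 'a \<Rightarrow> ('a \<Rightarrow> 'a) set set"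
  defines "FS \<equiv> \<lambda>x. induced_foliation M F (S x)"
    and "G \<equiv> germ_groupoid L S H"
  assumes "complex_manifold M"
    and "holomorphic_foliation M F"
    and "L \<in> leaves M F (points M)"
    and "\<forall>x \<in> L. transversal_at M F (S x) x"
    and "\<forall>x \<in> L. analytic_envelope (S x) (FS x) x (Q x) (q x)"
    and "groupoid G"
    and "\<forall>x \<in> L. \<forall>y \<in> L. H x y \<subseteq> leaf_preserving_germs (S x) (FS x) x (S y) (FS y) y"
  shows "\<exists>E.
    groupoid_functor G (Iso_groupoid (Q ` L)) Q E \<and>
    (\<forall>x \<in> L. \<forall>y \<in> L. \<forall>h \<in> Hom G x y.
       (\<forall>k. k \<in> amaps (Q x) (Q y) \<and>
            germ_comp (top_of (S x)) x (q y) h = germ_comp (top_of (S x)) x k (q x)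
            \<longleftrightarrow> k = E x y h)) \<and>
    (let \<K> = (\<lambda>x. {h \<in> Hom G x x. E x x h = amap_id (Q x)});
         K = bundle_subgroupoid G \<K>
     in wide_normal_subgroupoid K G \<and>
        groupoid_functor G (quotient_groupoid G K) (\<lambda>x. x) (arrow_coset G K) \<and>
        (\<exists>E'. groupoid_functor (quotient_groupoid G K) (Iso_groupoid (Q ` L)) Q E' \<and>
              faithful_on (quotient_groupoid G K) E' \<and>
              (\<forall>x \<in> L. \<forall>y \<in> L. \<forall>h \<in> Hom G x y.
                 E x y h = E' x y (arrow_coset G K x y h))) \<and>
        (\<forall>x \<in> L. \<K> x = {h \<in> Hom G x x.
            \<forall>f \<in> first_integrals (S x) (FS x) x. germ_comp (top_of (S x)) x f h = f}))"
proof -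
  \<comment> \<open>Transversality supplies the manifold structure of \<open>S x\<close> and the
    membership of x in it.\<close>
  interpret enveloped_transversals L S FS Q q H G
    using assms(6-9) unfolding G_def
    by unfold_locales (auto simp: transversal_at_def embedded_submanifold_def)
  define K where K_eq: "K = bundle_subgroupoid G (\<lambda>x. {h \<in> Hom G x x. induced x x h = amap_id (Q x)})"
  have Idn: "Idn (Iso_groupoid (Q ` L)) = amap_id" by (simp add: Iso_groupoid_def)
  interpret functor_kernel G "Iso_groupoid (Q ` L)" Q induced K
    by unfold_locales (simp_all add: K_eq Idn functor_induced)
  have "\<forall>k. k \<in> amaps (Q x) (Q y) \<and>
      germ_comp (top_of (S x)) x (q y) h = germ_comp (top_of (S x)) x k (q x) \<longleftrightarrow> k = induced x y h"
    if "x \<in> L" "y \<in> L" "h \<in> Hom G x y" for x y h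
    using induced_iff[of x y h] that unfolding G_simps by metis
  moreover have "{h \<in> Hom G x x. induced x x h = amap_id (Q x)} = {h \<in> Hom G x x.
      \<forall>f \<in> first_integrals (S x) (FS x) x. germ_comp (top_of (S x)) x f h = f}" if "x \<in> L" for x
    using induced_trivial_iff[OF that] unfolding G_simps by (intro Collect_cong conj_cong refl)
  moreover note functor_induced wide_normal_kernel functor_arrow_coset
    faithful_factorisation[unfolded G_simps(1)]
  ultimately show ?thesis
    \<comment> \<open>The let-bound subgroupoid depends on the functor and becomes \<open>K\<close>
      once \<open>induced\<close> is the witness.\<close>
    unfolding Let_def by (intro exI[of _ induced]; fold K_eq; intro conjI ballI) simp_all
qed

end
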